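(* There exists a constant $c>0$ such that for every integer $n\geq 1$, every $N\times N$ real matrix with $N\geq 2^{cn^{4}(\log n)^2}$ contains an $n\times n$ monotone submatrix. Equivalently, $M_2(n)\leq 2^{cn^{4}(\log n)^2}$ for all $n\geq 1$.
   Context: An $n\times n$ submatrix of a real matrix $A$ is obtained by choosing row indices $i_1<\dots<i_n$ and column indices $j_1<\dots<j_n$ and taking the matrix $B(k,l)=A(i_k,j_l)$. A finite sequence of reals is monotone if it is non-decreasing or non-increasing. A matrix is monotone if (i) every row is monotone, and either all rows are non-decreasing or all rows are non-increasing, and (ii) every column is monotone, and either all columns are non-decreasing or all columns are non-increasing. $M_2(n)$ denotes the smallest $N$ such that every $N\times N$ real matrix contains an $n\times n$ monotone submatrix. *)

theory Defs
  imports Complex_Main "Jordan_Normal_Form.DL_Submatrix"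
begin

definition monotone_mat :: "real mat \<Rightarrow> bool" where
  "monotone_mat B \<longleftrightarrow>
     ((\<forall>i<dim_row B. mono_on {..<dim_col B} (\<lambda>j. B $$ (i, j))) \<or>
      (\<forall>i<dim_row B. antimono_on {..<dim_col B} (\<lambda>j. B $$ (i, j)))) \<and>
     ((\<forall>j<dim_col B. mono_on {..<dim_row B} (\<lambda>i. B $$ (i, j))) \<or>
      (\<forall>j<dim_col B. antimono_on {..<dim_row B} (\<lambda>i. B $$ (i, j))))"

text \<open>Choosing increasing row indices \<open>i\<^sub>1 < \<dots> < i\<^sub>n\<close> amounts to choosing the
  set \<open>I\<close> of these indices, and likewise for columns: \<^const>\<open>submatrix\<close> enumerates
  the selected rows and columns in increasing order.\<close>

definition has_monotone_submatrix :: "nat \<Rightarrow> real mat \<Rightarrow> bool" where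
  "has_monotone_submatrix n A \<longleftrightarrow>
     (\<exists>I J. I \<subseteq> {..<dim_row A} \<and> card I = n \<and> J \<subseteq> {..<dim_col A} \<and> card J = n \<and>
        monotone_mat (submatrix A I J))"

text \<open>If no such \<open>N\<close> existed, the value of \<open>LEAST\<close> would be unspecified, so a bound on
  \<open>M\<^sub>2 n\<close> is only meaningful together with the existence of a suitable \<open>N\<close>.\<close>

definition M\<^sub>2 :: "nat \<Rightarrow> nat" where
  "M\<^sub>2 n = (LEAST N. \<forall>A \<in> carrier_mat N N. has_monotone_submatrix n A)"

end

theory Submission
  imports Defs "HOL-Analysis.Convex"
begin

text \<open>
  Fix \<open>n\<close> disjoint pools of columns and call an \<open>n\<close>-subset of a pool good for a row if the row is
  monotone on it. For a choice of one \<open>n\<close>-subset \<open>J c\<close> from each pool, order the rows for which all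
  \<open>J c\<close> are good by ``\<open>i < i'\<close>, row \<open>i'\<close> is nowhere above row \<open>i\<close> on \<open>J c\<close>, and both rows have the
  same direction on \<open>J c\<close>''. A chain of length \<open>n\<close> would be a monotone block, so each of these \<open>n\<close>
  orders has fewer than \<open>n\<close> levels, and many pairs \<open>i < i'\<close> share all their levels; such a pair
  rises somewhere on every \<open>J c\<close>. Averaging over all choices of \<open>J\<close> shows that for many pairs of rows
  the set of columns where \<open>i'\<close> exceeds \<open>i\<close> has positive density in every pool simultaneously.
  Iterating with the potential \<open>\<Sum>\<^sub>i \<Prod>\<^sub>c r\<^sub>c(i)\<^sup>n\<close>, where \<open>r\<^sub>c(i)\<close> is the number of columns of pool
  \<open>c\<close> still available to row \<open>i\<close>, gives \<open>n\<close> rows and one column per pool on which all columns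
  increase. Shrinking the pools beforehand, separately in each row, so that every row is monotone
  across the pools makes this a monotone block.
\<close>

subsection \<open>Levels of chains, monotone subsets and counting\<close>

text \<open>Mirsky's theorem, dual to Dilworth's: the level of \<open>x\<close> is the size of a
  longest chain in \<open>T\<close> with top element \<open>x\<close>, less one.\<close>

lemma chain_levels:
  fixes T :: "nat set" and R :: "nat \<Rightarrow> nat \<Rightarrow> bool"
  assumes fin: "finite T" and n: "n \<ge> 1"
    and less: "\<And>x y. R x y \<Longrightarrow> x < y"
    and trans: "\<And>x y z. R x y \<Longrightarrow> R y z \<Longrightarrow> R x z"
    and nochain: "\<And>I. I \<subseteq> T \<Longrightarrow> card I = n \<Longrightarrow> (\<forall>x\<in>I. \<forall>y\<in>I. x < y \<longrightarrow> R x y) \<Longrightarrow> False"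
  obtains f :: "nat \<Rightarrow> nat"
  where "\<And>x. x \<in> T \<Longrightarrow> f x < n - 1" "\<And>x y. x \<in> T \<Longrightarrow> y \<in> T \<Longrightarrow> R x y \<Longrightarrow> f x < f y"
proof -
  define ch where "ch = (\<lambda>I. \<forall>x\<in>I. \<forall>y\<in>I. x < y \<longrightarrow> R x y)"
  define E where "E = (\<lambda>x. {I. I \<subseteq> T \<and> ch I \<and> x \<in> I \<and> (\<forall>y\<in>I. y \<le> x)})"
  define g where "g = (\<lambda>x. Max (card ` E x))"
  have finE: "finite (E x)" for x
    unfolding E_def using fin by auto
  have sing: "{x} \<in> E x" if "x \<in> T" for x
    using that unfolding E_def ch_def by auto
  have small: "card I < n" if "I \<subseteq> T" "ch I" for I
  proof (rule ccontr)
    assume "\<not> card I < n"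
    then obtain I' where "I' \<subseteq> I" "card I' = n"
      by (meson not_less obtain_subset_with_card_n)
    then show False using nochain[of I'] that unfolding ch_def by blast
  qed
  have g_in: "\<exists>I\<in>E x. card I = g x" if "x \<in> T" for x
  proof -
    have "g x \<in> card ` E x"
      unfolding g_def using finE sing[OF that] by (intro Max_in) auto
    then show ?thesis by auto
  qed
  have g_ge: "card I \<le> g x" if "I \<in> E x" for I x
    unfolding g_def using finE that by auto
  have g1: "1 \<le> g x" if "x \<in> T" for x
    using g_ge[OF sing[OF that]] by simp
  have gn: "g x < n" if x: "x \<in> T" for x
  proof -
    obtain I where I: "I \<in> E x" "card I = g x" using g_in[OF x] by auto
    then show ?thesis using small[of I] unfolding E_def by simp
  qed
  have gless: "g x < g y" if x: "x \<in> T" and y: "y \<in> T" and xy': "R x y" for x y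
  proof -
    obtain I where I: "I \<in> E x" "card I = g x" using g_in[OF x] by auto
    have xy: "x < y" using less xy' by auto
    have "R z y" if "z \<in> I" for z
    proof (cases "z = x")
      case True then show ?thesis using \<open>R x y\<close> by simp
    next
      case False
      then have "z < x" using I that unfolding E_def by (auto simp: order_less_le)
      then have "R z x" using I that unfolding E_def ch_def by auto
      then show ?thesis using \<open>R x y\<close> trans by blast
    qed
    moreover have "z < y" if "z \<in> I" for z
      using I that xy unfolding E_def by (auto intro: le_less_trans)
    ultimately have "insert y I \<in> E y"
      using I y unfolding E_def ch_def by (auto dest: less_imp_le less_asym)
    moreover have "y \<notin> I" using \<open>\<And>z. z \<in> I \<Longrightarrow> z < y\<close> by blast
    moreover have "finite I" using I fin unfolding E_def by (auto intro: finite_subset)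
    ultimately show ?thesis using g_ge[of "insert y I" y] I(2) by auto
  qed
  \<comment> \<open>Longest chains have between 1 and \<open>n - 1\<close> elements, so counting
    levels from 0 leaves \<open>n - 1\<close> values.\<close>
  show thesis
  proof (rule that[of "\<lambda>x. g x - 1"])
    show "g x - 1 < n - 1" if "x \<in> T" for x using g1[OF that] gn[OF that] by linarith
    show "g x - 1 < g y - 1" if "x \<in> T" "y \<in> T" "R x y" for x y
      using g1[of x] g1[of y] gless[OF that] that by linarith
  qed
qed

text \<open>What the opening text calls good: \<open>J\<close> is good for the row
  \<open>v\<close>.\<close>

definition tame :: "(nat \<Rightarrow> real) \<Rightarrow> nat set \<Rightarrow> bool" where
  "tame v J \<longleftrightarrow> mono_on J v \<or> antimono_on J v"

lemma tame_subset: "tame v J \<Longrightarrow> J' \<subseteq> J \<Longrightarrow> tame v J'"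
  unfolding tame_def by (meson monotone_on_subset)

lemma mono_onI_less:
  fixes v :: "nat \<Rightarrow> real"
  assumes "\<And>x y. x \<in> J \<Longrightarrow> y \<in> J \<Longrightarrow> x < y \<Longrightarrow> v x \<le> v y"
  shows "mono_on J v"
  using assms by (intro monotone_onI) (metis order_le_less order_refl)

lemma antimono_onI_less:
  fixes v :: "nat \<Rightarrow> real"
  assumes "\<And>x y. x \<in> J \<Longrightarrow> y \<in> J \<Longrightarrow> x < y \<Longrightarrow> v y \<le> v x"
  shows "antimono_on J v"
  using assms by (intro monotone_onI) (metis order_le_less order_refl)

text \<open>Each position gets two levels, one for non-decreasing and one for non-increasing chains.
  Two positions cannot share both, whichever way their values compare, and only (n-1)^2 pairs of
  levels exist.\<close>

lemma erdos_szekeres: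
  fixes v :: "nat \<Rightarrow> real"
  assumes fin: "finite X" and n: "n \<ge> 1" and card: "card X > (n - 1)\<^sup>2"
  shows "\<exists>J. J \<subseteq> X \<and> card J = n \<and> tame v J"
proof (rule ccontr)
  assume "\<nexists>J. J \<subseteq> X \<and> card J = n \<and> tame v J"
  then have no: "\<not> tame v J" if "J \<subseteq> X" "card J = n" for J using that by blast
  obtain f where f: "\<And>x. x \<in> X \<Longrightarrow> f x < n - 1"
     "\<And>x y. x \<in> X \<Longrightarrow> y \<in> X \<Longrightarrow> x < y \<and> v x \<le> v y \<Longrightarrow> f x < f y"
  proof (rule chain_levels[OF fin n, of "\<lambda>x y. x < y \<and> v x \<le> v y"])
    fix I assume "I \<subseteq> X" "card I = n" "\<forall>x\<in>I. \<forall>y\<in>I. x < y \<longrightarrow> x < y \<and> v x \<le> v y"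
    then show False using no[of I] unfolding tame_def by (blast intro: mono_onI_less)
  qed auto
  obtain h where h: "\<And>x. x \<in> X \<Longrightarrow> h x < n - 1"
     "\<And>x y. x \<in> X \<Longrightarrow> y \<in> X \<Longrightarrow> x < y \<and> v y \<le> v x \<Longrightarrow> h x < h y"
  proof (rule chain_levels[OF fin n, of "\<lambda>x y. x < y \<and> v y \<le> v x"])
    fix I assume "I \<subseteq> X" "card I = n" "\<forall>x\<in>I. \<forall>y\<in>I. x < y \<longrightarrow> x < y \<and> v y \<le> v x"
    then show False using no[of I] unfolding tame_def by (blast intro: antimono_onI_less)
  qed auto
  have "(\<lambda>x. (f x, h x)) ` X \<subseteq> {..<n-1} \<times> {..<n-1}" using f h by auto
  then have "card ((\<lambda>x. (f x, h x)) ` X) \<le> card ({..<n-1} \<times> {..<n-1})"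
    by (intro card_mono) auto
  then have "card ((\<lambda>x. (f x, h x)) ` X) < card X"
    using card by (simp add: power2_eq_square)
  then have "\<not> inj_on (\<lambda>x. (f x, h x)) X" by (rule pigeonhole)
  then obtain x y where xy: "x \<in> X" "y \<in> X" "x < y" "f x = f y" "h x = h y"
    unfolding inj_on_def by (metis nat_neq_iff prod.inject)
  show False
    using f(2)[OF xy(1,2)] h(2)[OF xy(1,2)] xy(3-5) by (cases "v x \<le> v y") auto
qed

definition nsub :: "nat \<Rightarrow> nat set \<Rightarrow> nat set set" where
  "nsub n X = {J. J \<subseteq> X \<and> card J = n}"

lemma finite_nsub: "finite X \<Longrightarrow> finite (nsub n X)"
  unfolding nsub_def by auto

lemma card_nsub: "finite X \<Longrightarrow> card (nsub n X) = card X choose n"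
  unfolding nsub_def by (rule n_subsets)

lemma card_nsub_le: "finite X \<Longrightarrow> card (nsub n X) \<le> card X ^ n"
  by (cases "n \<le> card X") (auto simp: card_nsub binomial_eq_0 intro: binomial_le_pow)

text \<open>A \<open>p\<close>-subset is a member of \<open>F\<close> plus \<open>p - n\<close>
  further elements, so C(x,p) \<le> |F| C(x-n,p-n) with x = |X|. Counting pairs \<open>J\<close>
  inside \<open>Q\<close> turns this into C(x,n) \<le> |F| C(p,n); finally (x/n)^n \<le> C(x,n) and
  C(p,n) \<le> p^n.\<close>

lemma choose_subset_count:
  fixes X :: "nat set"
  assumes fin: "finite X" and pn: "n \<le> p" and px: "p \<le> card X" and n: "n \<ge> 1"
    and P: "\<And>Q. Q \<subseteq> X \<Longrightarrow> card Q = p \<Longrightarrow> \<exists>J\<in>F. J \<subseteq> Q"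
    and F: "F \<subseteq> nsub n X"
  shows "real (card X) ^ n \<le> real n ^ n * real p ^ n * real (card F)"
proof -
  let ?x = "card X"
  have finF: "finite F" using F finite_nsub[OF fin] finite_subset by blast
  have sub: "nsub p X \<subseteq> (\<Union>J\<in>F. (\<lambda>Z. J \<union> Z) ` nsub (p - n) (X - J))"
  proof
    fix Q assume "Q \<in> nsub p X"
    then have Q: "Q \<subseteq> X" "card Q = p" by (auto simp: nsub_def)
    then obtain J where J: "J \<in> F" "J \<subseteq> Q" using P by blast
    have "finite J" using J Q fin by (meson finite_subset)
    then have "card (Q - J) = p - n" using J F Q by (auto simp: nsub_def card_Diff_subset)
    then have "Q - J \<in> nsub (p - n) (X - J)" using Q by (auto simp: nsub_def)
    moreover have "Q = J \<union> (Q - J)" using J by auto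
    ultimately show "Q \<in> (\<Union>J\<in>F. (\<lambda>Z. J \<union> Z) ` nsub (p - n) (X - J))" using J(1) by blast
  qed
  have "?x choose p = card (nsub p X)" using card_nsub[OF fin] by simp
  also have "\<dots> \<le> card (\<Union>J\<in>F. (\<lambda>Z. J \<union> Z) ` nsub (p - n) (X - J))"
    using sub finF fin by (intro card_mono) (auto intro!: finite_nsub)
  also have "\<dots> \<le> (\<Sum>J\<in>F. card ((\<lambda>Z. J \<union> Z) ` nsub (p - n) (X - J)))"
    by (rule card_UN_le[OF finF])
  also have "\<dots> \<le> (\<Sum>J\<in>F. (?x - n) choose (p - n))"
  proof (rule sum_mono)
    fix J assume "J \<in> F"
    then have J: "J \<subseteq> X" "card J = n" using F by (auto simp: nsub_def)
    then have "finite J" using fin finite_subset by blast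
    have "card ((\<lambda>Z. J \<union> Z) ` nsub (p - n) (X - J)) \<le> card (nsub (p - n) (X - J))"
      using fin by (intro card_image_le finite_nsub) auto
    also have "\<dots> = (?x - n) choose (p - n)"
      using J \<open>finite J\<close> fin by (simp add: card_nsub card_Diff_subset)
    finally show "card ((\<lambda>Z. J \<union> Z) ` nsub (p - n) (X - J)) \<le> (?x - n) choose (p - n)" .
  qed
  finally have 1: "?x choose p \<le> card F * ((?x - n) choose (p - n))" by simp
  have 2: "(?x choose p) * (p choose n) = (?x choose n) * ((?x - n) choose (p - n))"
    using choose_mult[OF pn px] by simp
  have pos: "(?x - n) choose (p - n) > 0" using px by (intro zero_less_binomial) simp
  have "(?x choose n) * ((?x - n) choose (p - n)) \<le> card F * (p choose n) * ((?x - n) choose (p - n))"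
    unfolding 2[symmetric] using mult_right_mono[OF 1, of "p choose n"] by (simp add: mult_ac)
  then have 3: "?x choose n \<le> card F * (p choose n)" using pos by simp
  have "(real ?x / real n) ^ n \<le> real (?x choose n)"
    using binomial_ge_n_over_k_pow_k[of n ?x, where 'a = real] pn px by simp
  also have "\<dots> \<le> real (card F) * real (p choose n)" using 3 by (metis of_nat_le_iff of_nat_mult)
  also have "\<dots> \<le> real (card F) * real p ^ n"
    using binomial_le_pow[OF pn] by (intro mult_left_mono) (metis of_nat_le_iff of_nat_power, simp)
  finally show ?thesis using n by (simp add: power_divide field_simps)
qed

text \<open>Cauchy-Schwarz for the sizes of the fibres of \<open>g\<close>.\<close>

lemma card_square_le_fibres:
  fixes g :: "'a \<Rightarrow> 'b"
  assumes fin: "finite B" "finite C" and g: "g ` B \<subseteq> C"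
  shows "(real (card B))\<^sup>2 \<le> real (card C) * real (card {(x, y) \<in> B \<times> B. g x = g y})"
proof -
  define a where "a = (\<lambda>z. {x \<in> B. g x = z})"
  have fa: "finite (a z)" for z unfolding a_def using fin by auto
  have "B = (\<Union>z\<in>C. a z)" using g unfolding a_def by auto
  then have cB: "card B = (\<Sum>z\<in>C. card (a z))"
    using card_UN_disjoint[of C a] fin fa unfolding a_def by auto
  have "{(x, y) \<in> B \<times> B. g x = g y} = (\<Union>z\<in>C. a z \<times> a z)" using g unfolding a_def by auto
  then have "card {(x, y) \<in> B \<times> B. g x = g y} = (\<Sum>z\<in>C. card (a z \<times> a z))"
    using card_UN_disjoint[of C "\<lambda>z. a z \<times> a z"] fin fa unfolding a_def by fastforce
  then have c2: "real (card {(x, y) \<in> B \<times> B. g x = g y}) = (\<Sum>z\<in>C. (real (card (a z)))\<^sup>2)"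
    by (simp add: card_cartesian_product power2_eq_square)
  have "(\<Sum>z\<in>C. real (card (a z)))\<^sup>2 \<le> (\<Sum>z\<in>C. (real (card (a z)))\<^sup>2) * real (card C)"
    by (rule sum_squared_le_sum_of_squares)
  then show ?thesis unfolding c2 cB by (simp add: mult.commute)
qed

subsection \<open>Rows on the same level\<close>

text \<open>After exchanging the sums, the conditions on the coordinates of \<open>J\<close> are
  independent for fixed \<open>t\<close>, so the number of suitable \<open>J\<close>
  factors.\<close>

lemma double_count_PiE:
  fixes X :: "nat \<Rightarrow> 'b set" and T :: "'a set"
  assumes finT: "finite T" and finX: "\<And>c. c < n \<Longrightarrow> finite (X c)"
  shows "(\<Sum>J\<in>PiE {..<n} X. card {t \<in> T. \<forall>c<n. Q c t (J c)}) =
    (\<Sum>t\<in>T. \<Prod>c<n. card {j \<in> X c. Q c t j})"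
proof -
  let ?P = "PiE {..<n} X"
  have fin: "finite ?P" using finX by (intro finite_PiE) auto
  have filt: "card {x \<in> B. p x} = (\<Sum>x\<in>B. if p x then 1 else 0)" if "finite B" for B :: "'a set" and p
    using that by (simp add: sum.inter_filter[symmetric])
  have filt': "card {x \<in> B. p x} = (\<Sum>x\<in>B. if p x then 1 else 0)" if "finite B"
    for B :: "(nat \<Rightarrow> 'b) set" and p
    using that by (simp add: sum.inter_filter[symmetric])
  have "(\<Sum>J\<in>?P. card {t \<in> T. \<forall>c<n. Q c t (J c)}) =
      (\<Sum>t\<in>T. card {J \<in> ?P. \<forall>c<n. Q c t (J c)})"
  proof -
    have "(\<Sum>J\<in>?P. card {t \<in> T. \<forall>c<n. Q c t (J c)}) =
        (\<Sum>J\<in>?P. \<Sum>t\<in>T. if \<forall>c<n. Q c t (J c) then 1 else 0)"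
      using filt[OF finT] by simp
    also have "\<dots> = (\<Sum>t\<in>T. \<Sum>J\<in>?P. if \<forall>c<n. Q c t (J c) then 1 else 0)"
      by (rule sum.swap)
    also have "\<dots> = (\<Sum>t\<in>T. card {J \<in> ?P. \<forall>c<n. Q c t (J c)})"
      using filt'[OF fin] by simp
    finally show ?thesis .
  qed
  also have "\<dots> = (\<Sum>t\<in>T. \<Prod>c<n. card {j \<in> X c. Q c t j})"
  proof (rule sum.cong[OF refl])
    fix t
    have "{J \<in> ?P. \<forall>c<n. Q c t (J c)} = PiE {..<n} (\<lambda>c. {j \<in> X c. Q c t j})"
      unfolding PiE_def Pi_def by auto
    then show "card {J \<in> ?P. \<forall>c<n. Q c t (J c)} = (\<Prod>c<n. card {j \<in> X c. Q c t j})"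
      by (simp add: card_PiE)
  qed
  finally show ?thesis .
qed

definition mono_block :: "(nat \<Rightarrow> nat \<Rightarrow> real) \<Rightarrow> nat set \<Rightarrow> nat set \<Rightarrow> bool" where
  "mono_block A I J \<longleftrightarrow>
     ((\<forall>i\<in>I. mono_on J (A i)) \<or> (\<forall>i\<in>I. antimono_on J (A i))) \<and>
     ((\<forall>j\<in>J. mono_on I (\<lambda>i. A i j)) \<or> (\<forall>j\<in>J. antimono_on I (\<lambda>i. A i j)))"

text \<open>The assumption for contradiction, kept as a context until
  \<open>exists_mono_block\<close> refutes it.\<close>

locale no_mono_block =
  fixes A :: "nat \<Rightarrow> nat \<Rightarrow> real" and n :: nat and R C :: "nat set"
  assumes n_ge_2: "n \<ge> 2"
    and no_block: "I \<subseteq> R \<Longrightarrow> card I = n \<Longrightarrow> J \<subseteq> C \<Longrightarrow> card J = n \<Longrightarrow> \<not> mono_block A I J"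
begin

text \<open>With \<open>n\<close> levels and \<open>n\<close> directions a row has one of at most
  (2n)^n types. Two rows of one type that fail to rise on some \<open>J c\<close> would be
  comparable there and so differ in level. Cauchy-Schwarz provides many pairs of equal type.\<close>

lemma pair_count:
  assumes finT: "finite T" and TR: "T \<subseteq> R"
    and J: "\<And>c. c < n \<Longrightarrow> J c \<in> nsub n C"
    and tame: "\<And>i c. i \<in> T \<Longrightarrow> c < n \<Longrightarrow> tame (A i) (J c)"
  defines "P \<equiv> {(i, i') \<in> T \<times> T. i < i' \<and> (\<forall>c<n. \<exists>j\<in>J c. A i j < A i' j)}"
  shows "(real (card T))\<^sup>2 \<le> real (2 * n) ^ n * (2 * real (card P) + real (card T))"
proof -
  \<comment> \<open>Columns weakly fall along a chain. Asking for equal direction makes all rows of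
    a chain non-decreasing or all non-increasing, so a chain of \<open>n\<close> rows is a
    block.\<close>
  define Dn where "Dn = (\<lambda>c i i'. i < i' \<and> (\<forall>j\<in>J c. A i' j \<le> A i j) \<and>
      (mono_on (J c) (A i) \<longleftrightarrow> mono_on (J c) (A i')))"
  have "\<forall>c\<in>{..<n}. \<exists>f. (\<forall>x\<in>T. f x < n - 1) \<and> (\<forall>x\<in>T. \<forall>y\<in>T. Dn c x y \<longrightarrow> f x < f y)"
  proof
    fix c assume "c \<in> {..<n}"
    then have c: "c < n" by simp
    show "\<exists>f. (\<forall>x\<in>T. f x < n - 1) \<and> (\<forall>x\<in>T. \<forall>y\<in>T. Dn c x y \<longrightarrow> f x < f y)"
    proof (rule chain_levels[OF finT, of n "Dn c"])
      show "n \<ge> 1" using n_ge_2 by simp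
      show "Dn c x y \<Longrightarrow> x < y" for x y unfolding Dn_def by simp
      show "Dn c x y \<Longrightarrow> Dn c y z \<Longrightarrow> Dn c x z" for x y z
        unfolding Dn_def by (meson order_trans less_trans)
    next
      fix I assume I: "I \<subseteq> T" "card I = n" and ch: "\<forall>x\<in>I. \<forall>y\<in>I. x < y \<longrightarrow> Dn c x y"
      have same: "mono_on (J c) (A x) \<longleftrightarrow> mono_on (J c) (A y)" if "x \<in> I" "y \<in> I" for x y
        using ch that unfolding Dn_def by (metis nat_neq_iff)
      have "(\<forall>i\<in>I. mono_on (J c) (A i)) \<or> (\<forall>i\<in>I. antimono_on (J c) (A i))"
        using same tame[of _ c] I c unfolding tame_def by (meson subsetD)
      moreover have "\<forall>j\<in>J c. antimono_on I (\<lambda>i. A i j)"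
      proof
        fix j assume "j \<in> J c"
        then show "antimono_on I (\<lambda>i. A i j)"
          using ch unfolding Dn_def by (intro antimono_onI_less) auto
      qed
      ultimately have "mono_block A I (J c)" unfolding mono_block_def by blast
      then show False using no_block[of I "J c"] I TR J[OF c] by (auto simp: nsub_def)
    qed blast
  qed
  then obtain f where F: "\<forall>c\<in>{..<n}. (\<forall>x\<in>T. f c x < n - 1) \<and>
      (\<forall>x\<in>T. \<forall>y\<in>T. Dn c x y \<longrightarrow> f c x < f c y)"
    unfolding bchoice_iff by blast
  have f: "\<And>c x. c < n \<Longrightarrow> x \<in> T \<Longrightarrow> f c x < n - 1"
      "\<And>c x y. c < n \<Longrightarrow> x \<in> T \<Longrightarrow> y \<in> T \<Longrightarrow> Dn c x y \<Longrightarrow> f c x < f c y"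
    using F by blast+
  define g where "g = (\<lambda>i. \<lambda>c\<in>{..<n}. (f c i, mono_on (J c) (A i)))"
  let ?C = "PiE {..<n} (\<lambda>_. {..<n} \<times> (UNIV :: bool set))"
  have finC: "finite ?C" by (intro finite_PiE) auto
  have cardC: "card ?C = (2 * n) ^ n" by (simp add: card_PiE card_cartesian_product mult.commute)
  have "f c x < n" if "c < n" "x \<in> T" for c x using f(1)[OF that] by linarith
  then have "g ` T \<subseteq> ?C" unfolding g_def by (intro image_subsetI PiE_I) auto
  then have 1: "(real (card T))\<^sup>2 \<le> real (2 * n) ^ n * real (card {(x, y) \<in> T \<times> T. g x = g y})"
    using card_square_le_fibres[OF finT finC] unfolding cardC by simp
  have up: "(x, y) \<in> P" if "x \<in> T" "y \<in> T" "x < y" "g x = g y" for x y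
  proof -
    have "\<exists>j\<in>J c. A x j < A y j" if c: "c < n" for c
    proof (rule ccontr)
      assume "\<not> (\<exists>j\<in>J c. A x j < A y j)"
      moreover have "g x c = g y c" using \<open>g x = g y\<close> by simp
      then have e: "f c x = f c y" "mono_on (J c) (A x) \<longleftrightarrow> mono_on (J c) (A y)"
        using c unfolding g_def by auto
      ultimately have "Dn c x y" using \<open>x < y\<close> unfolding Dn_def by (auto simp: not_less)
      then show False using f(2)[OF c] e(1) \<open>x \<in> T\<close> \<open>y \<in> T\<close> by fastforce
    qed
    then show ?thesis using that unfolding P_def by simp
  qed
  have finP: "finite P" by (rule finite_subset[of _ "T \<times> T"]) (auto simp: P_def finT)
  \<comment> \<open>Two rows of equal type form a pair of \<open>P\<close> in one of its two orders,
    or are the same row.\<close>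
  have "{(x, y) \<in> T \<times> T. g x = g y} \<subseteq> P \<union> prod.swap ` P \<union> (\<lambda>x. (x, x)) ` T"
  proof
    fix z assume "z \<in> {(x, y) \<in> T \<times> T. g x = g y}"
    then obtain x y where z: "z = (x, y)" "x \<in> T" "y \<in> T" "g x = g y" by auto
    consider "x < y" | "y < x" | "x = y" by linarith
    then show "z \<in> P \<union> prod.swap ` P \<union> (\<lambda>x. (x, x)) ` T"
    proof cases
      case 1 then show ?thesis using up z by auto
    next
      case 2 then have "(y, x) \<in> P" using up z by auto
      then show ?thesis using z(1) by (metis UnI1 UnI2 image_eqI swap_simp)
    next
      case 3 then show ?thesis using z by auto
    qed
  qed
  then have "card {(x, y) \<in> T \<times> T. g x = g y} \<le> card (P \<union> prod.swap ` P \<union> (\<lambda>x. (x, x)) ` T)"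
    using finP finT by (intro card_mono) auto
  also have "\<dots> \<le> card P + card (prod.swap ` P) + card ((\<lambda>x. (x, x)) ` T)"
    by (meson add_mono card_Un_le order_trans order_refl)
  also have "\<dots> \<le> card P + card P + card T"
    using finP finT by (intro add_mono card_image_le) auto
  finally have "real (card {(x, y) \<in> T \<times> T. g x = g y}) \<le> 2 * real (card P) + real (card T)"
    by linarith
  then show ?thesis using 1 by (meson mult_left_mono order_trans of_nat_0_le_iff zero_le_power)
qed

end

section \<open>Counting subsets that are good for two rows\<close>

text \<open>Erdos-Szekeres twice: n^4 columns contain n^2 on which \<open>v\<close> is monotone, and
  these contain n on which \<open>w\<close> is monotone too. Then \<open>choose_subset_count\<close>
  with \<open>p = n ^ 4\<close> loses n^n n^(4n).\<close>

lemma two_row_tame_count: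
  assumes fin: "finite X" and n: "n \<ge> 1" and big: "card X \<ge> n ^ 4"
  shows "real (card X) ^ n \<le> real n ^ (5 * n) * real (card {J \<in> nsub n X. tame v J \<and> tame w J})"
proof -
  let ?F = "{J \<in> nsub n X. tame v J \<and> tame w J}"
  have "real (card X) ^ n \<le> real n ^ n * real (n ^ 4) ^ n * real (card ?F)"
  proof (rule choose_subset_count[OF fin _ big n])
    show "n \<le> n ^ 4" using n by (simp add: self_le_power)
  next
    fix Q assume Q: "Q \<subseteq> X" "card Q = n ^ 4"
    have finQ: "finite Q" using Q fin finite_subset by blast
    have a: "(m - 1)\<^sup>2 < m\<^sup>2" if "m \<ge> 1" for m :: nat using that by (intro power_strict_mono) auto
    have "card Q > (n\<^sup>2 - 1)\<^sup>2" using a[of "n\<^sup>2"] n Q(2) by simp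
    then obtain Q' where Q': "Q' \<subseteq> Q" "card Q' = n\<^sup>2" "tame v Q'"
      using erdos_szekeres[OF finQ, of "n\<^sup>2" v] n by auto
    have "card Q' > (n - 1)\<^sup>2" using a[of n] n Q'(2) by simp
    then obtain J where "J \<subseteq> Q'" "card J = n" "tame w J"
      using erdos_szekeres[of Q' n w] n finQ Q'(1) by (meson finite_subset)
    then show "\<exists>J\<in>?F. J \<subseteq> Q"
      using Q Q' tame_subset by (auto simp: nsub_def intro!: exI[of _ J])
  qed auto
  then show ?thesis by (simp add: power_mult[symmetric] power_add[symmetric] add.commute mult.commute)
qed

text \<open>Pick an element in \<open>U\<close> first, then the other \<open>n - 1\<close>.\<close>

lemma hitting_subsets_count:
  assumes fin: "finite X" and n: "n \<ge> 1" and U: "U \<subseteq> X"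
  shows "card {J \<in> nsub n X. J \<inter> U \<noteq> {}} \<le> card U * card X ^ (n - 1)"
proof -
  have sub: "{J \<in> nsub n X. J \<inter> U \<noteq> {}} \<subseteq> (\<Union>j\<in>U. insert j ` nsub (n - 1) X)"
  proof
    fix J assume "J \<in> {J \<in> nsub n X. J \<inter> U \<noteq> {}}"
    then obtain j where j: "J \<subseteq> X" "card J = n" "j \<in> J" "j \<in> U" by (auto simp: nsub_def)
    then have "J - {j} \<in> nsub (n - 1) X" using fin by (auto simp: nsub_def card_Diff_singleton finite_subset)
    moreover have "J = insert j (J - {j})" using j by auto
    ultimately show "J \<in> (\<Union>j\<in>U. insert j ` nsub (n - 1) X)" using j(4) by blast
  qed
  have finU: "finite U" using U fin finite_subset by blast
  have "card {J \<in> nsub n X. J \<inter> U \<noteq> {}} \<le> card (\<Union>j\<in>U. insert j ` nsub (n - 1) X)"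
    using sub finU fin by (intro card_mono) (auto simp: finite_nsub)
  also have "\<dots> \<le> (\<Sum>j\<in>U. card (insert j ` nsub (n - 1) X))" by (rule card_UN_le[OF finU])
  also have "\<dots> \<le> (\<Sum>j\<in>U. card X ^ (n - 1))"
  proof (rule sum_mono)
    fix j
    have "card (insert j ` nsub (n - 1) X) \<le> card (nsub (n - 1) X)"
      using fin by (intro card_image_le finite_nsub)
    also have "\<dots> \<le> card X ^ (n - 1)" by (rule card_nsub_le[OF fin])
    finally show "card (insert j ` nsub (n - 1) X) \<le> card X ^ (n - 1)" .
  qed
  finally show ?thesis by simp
qed

context no_mono_block
begin

text \<open>For two rows and pool \<open>c\<close>: \<open>x c\<close> common columns, \<open>u c\<close> of them rising, \<open>m c\<close> subsets good
  for both rows, \<open>p c\<close> of which contain a rising column. If some \<open>u c / x c\<close> is below \<open>\<mu>\<close>, then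
  that pool alone makes \<open>\<Prod> p\<close> negligible against \<open>\<Prod> m\<close>.\<close>

lemma pair_product_bound:
  fixes u x m p :: "nat \<Rightarrow> real" and \<mu> K :: real
  assumes \<mu>: "\<mu> > 0" "\<mu> * real n ^ 4 \<le> 1" and K: "K > 0"
    and nonneg: "\<And>c. c < n \<Longrightarrow> u c \<ge> 0" "\<And>c. c < n \<Longrightarrow> x c \<ge> 0"
      "\<And>c. c < n \<Longrightarrow> p c \<ge> 0"
    and u_small: "\<And>c. c < n \<Longrightarrow> u c < 1 \<Longrightarrow> u c = 0"
    and pm: "\<And>c. c < n \<Longrightarrow> p c \<le> m c" and px: "\<And>c. c < n \<Longrightarrow> p c \<le> x c ^ n"
    and pu: "\<And>c. c < n \<Longrightarrow> p c \<le> u c * x c ^ (n - 1)"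
    and mx: "\<And>c. c < n \<Longrightarrow> x c \<ge> real n ^ 4 \<Longrightarrow> x c ^ n \<le> K * m c"
  shows "(\<Prod>c<n. p c) \<le> (\<Prod>c<n. u c ^ n) / \<mu> ^ (n\<^sup>2) + \<mu> * K * (\<Prod>c<n. m c)"
proof (cases "\<forall>c<n. u c \<ge> \<mu> * x c")
  case True
  have "(\<Prod>c<n. p c) \<le> (\<Prod>c<n. (u c / \<mu>) ^ n)"
  proof (rule prod_mono)
    fix c assume c: "c \<in> {..<n}"
    have "x c \<le> u c / \<mu>" using True c \<mu> by (simp add: pos_le_divide_eq mult.commute)
    then have "x c ^ n \<le> (u c / \<mu>) ^ n" using c nonneg by (intro power_mono) auto
    then show "0 \<le> p c \<and> p c \<le> (u c / \<mu>) ^ n" using px[of c] nonneg(3)[of c] c by auto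
  qed
  also have "\<dots> = (\<Prod>c<n. u c ^ n) / \<mu> ^ (n\<^sup>2)"
    by (simp add: power_divide prod_dividef power_mult[symmetric] power2_eq_square)
  finally have 1: "(\<Prod>c<n. p c) \<le> (\<Prod>c<n. u c ^ n) / \<mu> ^ (n\<^sup>2)" .
  have "0 \<le> (\<Prod>c<n. m c)"
    using nonneg(3) pm by (intro prod_nonneg) (meson lessThan_iff order_trans)
  then have "0 \<le> \<mu> * K * (\<Prod>c<n. m c)" using \<mu> K by simp
  then show ?thesis using 1 by linarith
next
  case False
  then obtain d where d: "d < n" "u d < \<mu> * x d" by (auto simp: not_le)
  have m0: "0 \<le> m c" if "c < n" for c using nonneg(3)[OF that] pm[OF that] by linarith
  have pd: "p d \<le> \<mu> * K * m d"
  proof (cases "x d \<ge> real n ^ 4")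
    case True
    have "p d \<le> (\<mu> * x d) * x d ^ (n - 1)"
      using pu[OF d(1)] d nonneg by (meson mult_right_mono less_imp_le order_trans zero_le_power)
    also have "\<dots> = \<mu> * x d ^ n" using n_ge_2 by (cases n) auto
    also have "\<dots> \<le> \<mu> * (K * m d)" using mx[OF d(1) True] \<mu> by (intro mult_left_mono) auto
    finally show ?thesis by (simp add: mult.assoc)
  next
    case False
    \<comment> \<open>With so few common columns \<open>u d\<close> is below 1, hence 0 by
      \<open>u_small\<close>, which expresses that \<open>u\<close> is a cardinality.\<close>
    then have "\<mu> * x d \<le> \<mu> * real n ^ 4" using \<mu> by (intro mult_left_mono) auto
    then have "u d = 0" using u_small[OF d(1)] d \<mu> by linarith
    then have "p d \<le> 0" using pu[OF d(1)] by simp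
    then show ?thesis using m0[OF d(1)] \<mu> K by (meson mult_nonneg_nonneg less_imp_le order_trans)
  qed
  have "(\<Prod>c<n. p c) = p d * (\<Prod>c\<in>{..<n} - {d}. p c)"
    using d by (intro prod.remove) auto
  also have "\<dots> \<le> (\<mu> * K * m d) * (\<Prod>c\<in>{..<n} - {d}. m c)"
    using pd pm nonneg m0 d \<mu> K by (intro mult_mono prod_mono prod_nonneg) auto
  also have "\<dots> = \<mu> * K * (\<Prod>c<n. m c)"
    using d prod.remove[of "{..<n}" d m] by simp
  finally have 1: "(\<Prod>c<n. p c) \<le> \<mu> * K * (\<Prod>c<n. m c)" .
  have "0 \<le> (\<Prod>c<n. u c ^ n) / \<mu> ^ (n\<^sup>2)"
    using nonneg \<mu> by (intro divide_nonneg_nonneg prod_nonneg) auto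
  then show ?thesis using 1 by linarith
qed

text \<open>\<open>In c i\<close> stands for the columns of pool \<open>c\<close> still available to
  row \<open>i\<close>. The cardinalities of \<open>common\<close> and \<open>rise\<close>, then
  \<open>mcount\<close> and \<open>pcount\<close>, are the x, u, m, p of
  \<open>pair_product_bound\<close>.\<close>

definition common :: "(nat \<Rightarrow> nat \<Rightarrow> nat set) \<Rightarrow> nat \<Rightarrow> nat \<Rightarrow> nat \<Rightarrow> nat set" where
  "common In c i i' = In c i \<inter> In c i'"

definition rise :: "(nat \<Rightarrow> nat \<Rightarrow> nat set) \<Rightarrow> nat \<Rightarrow> nat \<Rightarrow> nat \<Rightarrow> nat set" where
  "rise In c i i' = {j \<in> In c i \<inter> In c i'. A i j < A i' j}"

definition mcount :: "(nat \<Rightarrow> nat \<Rightarrow> nat set) \<Rightarrow> nat \<Rightarrow> nat \<Rightarrow> nat \<Rightarrow> nat" where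
  "mcount In c i i' = card {J \<in> nsub n (common In c i i'). tame (A i) J \<and> tame (A i') J}"

definition pcount :: "(nat \<Rightarrow> nat \<Rightarrow> nat set) \<Rightarrow> nat \<Rightarrow> nat \<Rightarrow> nat \<Rightarrow> nat" where
  "pcount In c i i' = card {J \<in> nsub n (common In c i i').
     tame (A i) J \<and> tame (A i') J \<and> (\<exists>j\<in>J. A i j < A i' j)}"

lemma pcount_product_bound:
  assumes fin: "\<And>c. c < n \<Longrightarrow> finite (In c i)"
    and \<mu>: "\<mu> > 0" "\<mu> * real n ^ 4 \<le> 1"
  shows "(\<Prod>c<n. real (pcount In c i i')) \<le>
    (\<Prod>c<n. real (card (rise In c i i')) ^ n) / \<mu> ^ (n\<^sup>2) +
    \<mu> * real n ^ (5 * n) * (\<Prod>c<n. real (mcount In c i i'))"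
proof (rule pair_product_bound[where x = "\<lambda>c. real (card (common In c i i'))"])
  fix c assume c: "c < n"
  let ?X = "common In c i i'"
  have finX: "finite ?X" using fin[OF c] unfolding common_def by simp
  have finN: "finite {J \<in> nsub n ?X. Q J}" for Q using finite_nsub[OF finX] by simp
  have n1: "n \<ge> 1" using n_ge_2 by simp
  show "real (pcount In c i i') \<le> real (mcount In c i i')"
    unfolding pcount_def mcount_def using finN by (intro of_nat_mono card_mono) auto
  have "pcount In c i i' \<le> card (nsub n ?X)"
    unfolding pcount_def using finite_nsub[OF finX] by (intro card_mono) auto
  also have "\<dots> \<le> card ?X ^ n" by (rule card_nsub_le[OF finX])
  finally show "real (pcount In c i i') \<le> real (card ?X) ^ n"
    by (metis of_nat_le_iff of_nat_power)
  have "pcount In c i i' \<le> card {J \<in> nsub n ?X. J \<inter> rise In c i i' \<noteq> {}}"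
    unfolding pcount_def using finN
    by (intro card_mono) (auto simp: nsub_def common_def rise_def)
  also have "\<dots> \<le> card (rise In c i i') * card ?X ^ (n - 1)"
    by (rule hitting_subsets_count[OF finX n1]) (auto simp: rise_def common_def)
  finally show "real (pcount In c i i') \<le> real (card (rise In c i i')) * real (card ?X) ^ (n - 1)"
    by (metis of_nat_le_iff of_nat_mult of_nat_power)
  show "real (card ?X) ^ n \<le> real n ^ (5 * n) * real (mcount In c i i')"
    if "real n ^ 4 \<le> real (card ?X)"
    unfolding mcount_def using that
    by (intro two_row_tame_count[OF finX n1]) (metis of_nat_le_iff of_nat_power)
qed (use \<mu> n_ge_2 in auto)

text \<open>\<open>pair_count\<close>, summed over all ways to choose an \<open>n\<close>-subset from each pool.\<close>

lemma rise_sum_bound: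
  fixes T :: "nat set" and In :: "nat \<Rightarrow> nat \<Rightarrow> nat set"
  assumes finT: "finite T" and TR: "T \<subseteq> R"
    and finS: "\<And>c. c < n \<Longrightarrow> finite (S c)" and SC: "\<And>c. c < n \<Longrightarrow> S c \<subseteq> C"
    and In: "\<And>c i. c < n \<Longrightarrow> i \<in> T \<Longrightarrow> In c i \<subseteq> S c"
    and \<mu>: "\<mu> > 0" "8 * real (2 * n) ^ n * real n ^ (5 * n) * \<mu> = 1"
  defines "D \<equiv> \<Sum>i\<in>T. \<Prod>c<n. real (mcount In c i i)"
  assumes big: "2 * real (2 * n) ^ n * (\<Prod>c<n. real (card (S c)) ^ n) \<le> D"
  shows "D\<^sup>2 * \<mu> ^ (n\<^sup>2) \<le> 8 * real (2 * n) ^ n * (\<Prod>c<n. real (card (S c)) ^ n) *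
    (\<Sum>(i, i')\<in>{(i, i') \<in> T \<times> T. i < i'}. \<Prod>c<n. real (card (rise In c i i')) ^ n)"
proof -
  let ?P = "PiE {..<n} (\<lambda>c. nsub n (S c))"
  let ?q = "real (2 * n) ^ n"
  let ?s = "\<Prod>c<n. real (card (S c)) ^ n"
  \<comment> \<open>\<open>TJ J\<close> holds the rows for which the choice \<open>J\<close> is
    available and good, \<open>Pr J\<close> the pairs of them rising on every \<open>J c\<close>.
    \<open>D\<close> and \<open>Y\<close> are the sums of |TJ J| and of its square over all
    \<open>J\<close>.\<close>
  define TJ where "TJ = (\<lambda>J. {i \<in> T. \<forall>c<n. J c \<subseteq> In c i \<and> tame (A i) (J c)})"
  define Pr where "Pr = (\<lambda>J. {(i, i') \<in> TJ J \<times> TJ J. i < i' \<and> (\<forall>c<n. \<exists>j\<in>J c. A i j < A i' j)})"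
  define Y where "Y = (\<Sum>(i, i')\<in>T \<times> T. \<Prod>c<n. real (mcount In c i i'))"
  let ?TT = "{(i, i') \<in> T \<times> T. i < i'}"
  have q1: "?q \<ge> 1" using n_ge_2 by (intro one_le_power) simp
  have finTT: "finite ?TT" by (rule finite_subset[of _ "T \<times> T"]) (auto simp: finT)
  have finN: "finite (nsub n (S c))" if "c < n" for c using finite_nsub[OF finS[OF that]] .
  have finP: "finite ?P" using finN by (intro finite_PiE) auto
  have cardP: "real (card ?P) \<le> ?s"
  proof -
    have "card ?P \<le> (\<Prod>c<n. card (S c) ^ n)"
      using card_nsub_le[OF finS] by (simp add: card_PiE) (intro prod_mono, auto)
    then have "real (card ?P) \<le> real (\<Prod>c<n. card (S c) ^ n)" by (rule of_nat_mono)
    then show ?thesis by simp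
  qed
  have finTJ: "finite (TJ J)" for J unfolding TJ_def using finT by simp
  have mset: "{J \<in> nsub n (S c). J \<subseteq> In c i \<and> tame (A i) J \<and> J \<subseteq> In c i' \<and> tame (A i') J} =
      {J \<in> nsub n (common In c i i'). tame (A i) J \<and> tame (A i') J}"
    if "c < n" "i \<in> T" for c i i'
    using In[OF that] unfolding nsub_def common_def by auto
  have D: "(\<Sum>J\<in>?P. real (card (TJ J))) = D"
  proof -
    have "(\<Sum>J\<in>?P. card (TJ J)) =
        (\<Sum>i\<in>T. \<Prod>c<n. card {J \<in> nsub n (S c). J \<subseteq> In c i \<and> tame (A i) J})"
      unfolding TJ_def by (rule double_count_PiE[OF finT finN])
    also have "\<dots> = (\<Sum>i\<in>T. \<Prod>c<n. mcount In c i i)"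
      unfolding mcount_def using mset[of _ i i for i] by (intro sum.cong prod.cong arg_cong[where f = card] refl) auto
    finally show ?thesis unfolding D_def by (simp flip: of_nat_sum of_nat_prod)
  qed
  have Y: "(\<Sum>J\<in>?P. (real (card (TJ J)))\<^sup>2) = Y"
  proof -
    have "TJ J \<times> TJ J = {t \<in> T \<times> T. \<forall>c<n. J c \<subseteq> In c (fst t) \<and> tame (A (fst t)) (J c) \<and>
        J c \<subseteq> In c (snd t) \<and> tame (A (snd t)) (J c)}" for J
      by (rule Set.set_eqI) (simp add: TJ_def mem_Times_iff, blast)
    then have "(\<Sum>J\<in>?P. card (TJ J \<times> TJ J)) =
        (\<Sum>t\<in>T \<times> T. \<Prod>c<n. card {J \<in> nsub n (S c). J \<subseteq> In c (fst t) \<and> tame (A (fst t)) J \<and>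
        J \<subseteq> In c (snd t) \<and> tame (A (snd t)) J})"
      using double_count_PiE[of "T \<times> T" n "\<lambda>c. nsub n (S c)"
          "\<lambda>c t J. J \<subseteq> In c (fst t) \<and> tame (A (fst t)) J \<and> J \<subseteq> In c (snd t) \<and> tame (A (snd t)) J"]
        finT finN by simp
    also have "\<dots> = (\<Sum>t\<in>T \<times> T. \<Prod>c<n. mcount In c (fst t) (snd t))"
      unfolding mcount_def by (intro sum.cong prod.cong arg_cong[where f = card] refl mset) auto
    finally have "(\<Sum>J\<in>?P. real (card (TJ J \<times> TJ J))) =
        (\<Sum>t\<in>T \<times> T. \<Prod>c<n. real (mcount In c (fst t) (snd t)))"
      by (simp flip: of_nat_sum of_nat_prod)
    then show ?thesis
      unfolding Y_def by (simp add: card_cartesian_product power2_eq_square case_prod_unfold)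
  qed
  have U: "(\<Sum>J\<in>?P. real (card (Pr J))) \<le> (\<Sum>(i, i')\<in>?TT. \<Prod>c<n. real (pcount In c i i'))"
  proof -
    have "Pr J = {t \<in> ?TT. \<forall>c<n. J c \<subseteq> In c (fst t) \<and> tame (A (fst t)) (J c) \<and>
        J c \<subseteq> In c (snd t) \<and> tame (A (snd t)) (J c) \<and> (\<exists>j\<in>J c. A (fst t) j < A (snd t) j)}" for J
      by (rule Set.set_eqI) (simp add: Pr_def TJ_def case_prod_unfold mem_Times_iff, blast)
    then have "(\<Sum>J\<in>?P. card (Pr J)) =
        (\<Sum>t\<in>?TT. \<Prod>c<n. card {J \<in> nsub n (S c). J \<subseteq> In c (fst t) \<and> tame (A (fst t)) J \<and>
        J \<subseteq> In c (snd t) \<and> tame (A (snd t)) J \<and> (\<exists>j\<in>J. A (fst t) j < A (snd t) j)})"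
      using double_count_PiE[of ?TT n "\<lambda>c. nsub n (S c)"
          "\<lambda>c t J. J \<subseteq> In c (fst t) \<and> tame (A (fst t)) J \<and> J \<subseteq> In c (snd t) \<and>
            tame (A (snd t)) J \<and> (\<exists>j\<in>J. A (fst t) j < A (snd t) j)"]
        finTT finN by simp
    also have "\<dots> = (\<Sum>t\<in>?TT. \<Prod>c<n. pcount In c (fst t) (snd t))"
      unfolding pcount_def
    proof (intro sum.cong prod.cong arg_cong[where f = card] refl)
      fix t c assume "t \<in> ?TT" "c \<in> {..<n}"
      then have "c < n" "fst t \<in> T" by auto
      then have "In c (fst t) \<subseteq> S c" by (rule In)
      then show "{J \<in> nsub n (S c). J \<subseteq> In c (fst t) \<and> tame (A (fst t)) J \<and>
          J \<subseteq> In c (snd t) \<and> tame (A (snd t)) J \<and> (\<exists>j\<in>J. A (fst t) j < A (snd t) j)} =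
        {J \<in> nsub n (common In c (fst t) (snd t)).
          tame (A (fst t)) J \<and> tame (A (snd t)) J \<and> (\<exists>j\<in>J. A (fst t) j < A (snd t) j)}"
        unfolding nsub_def common_def by auto
    qed
    finally have "(\<Sum>J\<in>?P. real (card (Pr J))) =
        (\<Sum>t\<in>?TT. \<Prod>c<n. real (pcount In c (fst t) (snd t)))"
      by (simp flip: of_nat_sum of_nat_prod)
    then show ?thesis by (simp add: case_prod_unfold)
  qed
  let ?W = "\<Sum>(i, i')\<in>?TT. \<Prod>c<n. real (card (rise In c i i')) ^ n"
  let ?K = "real n ^ (5 * n)"
  have \<mu>n: "\<mu> * real n ^ 4 \<le> 1"
  proof -
    have "real n ^ 4 \<le> 1 * ?K" using n_ge_2 by (simp add: power_increasing)
    also have "\<dots> \<le> (8 * ?q) * ?K" using q1 by (intro mult_right_mono) auto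
    finally have "\<mu> * real n ^ 4 \<le> \<mu> * (8 * ?q * ?K)" using \<mu>(1) by (intro mult_left_mono) auto
    then show ?thesis using \<mu>(2) by (simp add: mult_ac)
  qed
  have "Y \<le> ?q * (2 * (\<Sum>J\<in>?P. real (card (Pr J))) + D)"
  proof -
    have "(real (card (TJ J)))\<^sup>2 \<le> ?q * (2 * real (card (Pr J)) + real (card (TJ J)))"
      if J: "J \<in> ?P" for J
      unfolding Pr_def
    proof (rule pair_count[OF finTJ])
      show "TJ J \<subseteq> R" using TR unfolding TJ_def by auto
      show "J c \<in> nsub n C" if "c < n" for c
        using J that SC[OF that] unfolding nsub_def by (auto simp: PiE_iff)
      show "tame (A i) (J c)" if "i \<in> TJ J" "c < n" for i c using that unfolding TJ_def by auto
    qed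
    then have "Y \<le> (\<Sum>J\<in>?P. ?q * (2 * real (card (Pr J)) + real (card (TJ J))))"
      unfolding Y[symmetric] by (rule sum_mono)
    also have "\<dots> = ?q * (2 * (\<Sum>J\<in>?P. real (card (Pr J))) + D)"
      unfolding D[symmetric] by (simp add: sum_distrib_left sum.distrib algebra_simps)
    finally show ?thesis .
  qed
  also have "(\<Sum>J\<in>?P. real (card (Pr J))) \<le> ?W / \<mu> ^ (n\<^sup>2) + \<mu> * ?K * Y"
  proof -
    have "(\<Sum>J\<in>?P. real (card (Pr J))) \<le> (\<Sum>(i, i')\<in>?TT.
        (\<Prod>c<n. real (card (rise In c i i')) ^ n) / \<mu> ^ (n\<^sup>2) +
        \<mu> * ?K * (\<Prod>c<n. real (mcount In c i i')))"
    proof (rule order_trans[OF U], rule sum_mono, clarify)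
      fix i i' assume "i \<in> T"
      then show "(\<Prod>c<n. real (pcount In c i i')) \<le>
        (\<Prod>c<n. real (card (rise In c i i')) ^ n) / \<mu> ^ (n\<^sup>2) +
        \<mu> * ?K * (\<Prod>c<n. real (mcount In c i i'))"
        using finite_subset[OF In finS] \<mu>(1) \<mu>n by (intro pcount_product_bound) auto
    qed
    also have "\<dots> = ?W / \<mu> ^ (n\<^sup>2) + \<mu> * ?K * (\<Sum>(i, i')\<in>?TT. \<Prod>c<n. real (mcount In c i i'))"
      by (simp add: case_prod_unfold sum.distrib sum_divide_distrib sum_distrib_left)
    also have "\<dots> \<le> ?W / \<mu> ^ (n\<^sup>2) + \<mu> * ?K * Y"
      unfolding Y_def using \<mu>(1) finT
      by (intro add_left_mono mult_left_mono sum_mono2) (auto intro: prod_nonneg)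
    finally show ?thesis .
  qed
  finally have "Y \<le> ?q * (2 * (?W / \<mu> ^ (n\<^sup>2) + \<mu> * ?K * Y) + D)"
    using q1 by (simp add: mult_left_mono)
  then have "Y \<le> 2 * ?q * (?W / \<mu> ^ (n\<^sup>2)) + 2 * (?q * ?K * \<mu>) * Y + ?q * D"
    by (simp add: algebra_simps)
  \<comment> \<open>The choice of \<mu> makes the \<open>Y\<close> term on the right equal to Y/4,
    which the left side absorbs.\<close>
  moreover have e: "?q * ?K * \<mu> = 1 / 8" using \<mu>(2) by simp
  have "3 * y \<le> 8 * q * x + 4 * (q * d)" if "y \<le> 2 * q * x + 2 * (1 / 8) * y + q * d"
    for y q x d :: real using that by simp
  ultimately have Y1: "3 * Y \<le> 8 * ?q * (?W / \<mu> ^ (n\<^sup>2)) + 4 * (?q * D)" unfolding e by blast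
  have D0: "0 \<le> D" unfolding D_def by (intro sum_nonneg prod_nonneg) auto
  \<comment> \<open>Cauchy-Schwarz over the at most \<open>?s\<close> choices of
    \<open>J\<close>.\<close>
  have CS: "D\<^sup>2 \<le> Y * ?s"
  proof -
    have "D\<^sup>2 \<le> Y * real (card ?P)"
      unfolding D[symmetric] Y[symmetric] by (rule sum_squared_le_sum_of_squares)
    also have "\<dots> \<le> Y * ?s"
      unfolding Y[symmetric] using cardP by (intro mult_left_mono sum_nonneg) auto
    finally show ?thesis .
  qed
  have s0: "?s \<ge> 0" by (intro prod_nonneg) auto
  \<comment> \<open>By \<open>big\<close> the contribution of equal rows is minor: 4 q D s is at
    most 2 D^2, against 3 D^2 on the left.\<close>
  have "(2 * ?q * ?s) * D \<le> D * D" using big D0 by (intro mult_right_mono)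
  then have "2 * (?q * D * ?s) \<le> D\<^sup>2" by (simp add: power2_eq_square mult_ac)
  moreover have "3 * (Y * ?s) \<le> 8 * ?q * (?W / \<mu> ^ (n\<^sup>2)) * ?s + 4 * (?q * D * ?s)"
    using mult_right_mono[OF Y1 s0] by (simp add: algebra_simps)
  ultimately have "D\<^sup>2 \<le> 8 * ?q * (?W / \<mu> ^ (n\<^sup>2)) * ?s" using CS by linarith
  then have "D\<^sup>2 * \<mu> ^ (n\<^sup>2) \<le> 8 * ?q * (?W / \<mu> ^ (n\<^sup>2)) * ?s * \<mu> ^ (n\<^sup>2)"
    using \<mu>(1) by (intro mult_right_mono) auto
  also have "\<dots> = 8 * ?q * ?s * ?W" using \<mu>(1) by (simp add: field_simps)
  finally show ?thesis .
qed

end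

subsection \<open>Rows that rise on every pool\<close>

context no_mono_block
begin

text \<open>Passes from the potential to the number of good subsets. Rows with n^4 columns in every
  pool fall under \<open>two_row_tame_count\<close>. Any other row has a thin pool, which by
  \<open>large\<close> pays a factor 2M; together such rows make up at most half of the
  potential.\<close>

lemma mcount_diag_sum_bound:
  fixes T :: "nat set" and In :: "nat \<Rightarrow> nat \<Rightarrow> nat set" and M :: real
  assumes finT: "finite T" and cT: "real (card T) \<le> M"
    and finS: "\<And>c. c < n \<Longrightarrow> finite (S c)"
    and In: "\<And>c i. c < n \<Longrightarrow> i \<in> T \<Longrightarrow> In c i \<subseteq> S c"
    and large: "\<And>c. c < n \<Longrightarrow> 2 * M * real n ^ (4 * n) \<le> real (card (S c)) ^ n"
    and M: "M \<ge> 1"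
  defines "s \<equiv> \<Prod>c<n. real (card (S c)) ^ n"
  assumes \<Phi>: "s \<le> (\<Sum>i\<in>T. \<Prod>c<n. real (card (In c i)) ^ n)"
  shows "(\<Sum>i\<in>T. \<Prod>c<n. real (card (In c i)) ^ n) \<le>
    2 * (real n ^ (5 * n)) ^ n * (\<Sum>i\<in>T. \<Prod>c<n. real (mcount In c i i))"
proof -
  let ?K = "real n ^ (5 * n)"
  let ?r = "\<lambda>i. \<Prod>c<n. real (card (In c i)) ^ n"
  define Tb where "Tb = {i \<in> T. \<exists>c<n. card (In c i) < n ^ 4}"
  have finI: "finite (In c i)" if "c < n" "i \<in> T" for c i
    using In[OF that] finS[OF that(1)] finite_subset by blast
  have s0: "s \<ge> 0" unfolding s_def by (intro prod_nonneg) auto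
  have r0: "?r i \<ge> 0" for i by (intro prod_nonneg) auto
  have bad: "2 * M * ?r i \<le> s" if "i \<in> Tb" for i
  proof -
    obtain d where d: "d < n" "card (In d i) < n ^ 4" and iT: "i \<in> T" using \<open>i \<in> Tb\<close> unfolding Tb_def by auto
    have "real (card (In d i)) \<le> real n ^ 4" using d(2) by (metis less_imp_le of_nat_le_iff of_nat_power)
    then have "real (card (In d i)) ^ n \<le> (real n ^ 4) ^ n" by (intro power_mono) auto
    then have "2 * M * real (card (In d i)) ^ n \<le> 2 * M * real n ^ (4 * n)"
      using M by (intro mult_left_mono) (auto simp: power_mult)
    also have "\<dots> \<le> real (card (S d)) ^ n" by (rule large[OF d(1)])
    finally have 1: "2 * M * real (card (In d i)) ^ n \<le> real (card (S d)) ^ n" .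
    have "2 * M * ?r i = (2 * M * real (card (In d i)) ^ n) * (\<Prod>c\<in>{..<n} - {d}. real (card (In c i)) ^ n)"
      using d prod.remove[of "{..<n}" d "\<lambda>c. real (card (In c i)) ^ n"] by simp
    also have "\<dots> \<le> real (card (S d)) ^ n * (\<Prod>c\<in>{..<n} - {d}. real (card (S c)) ^ n)"
    proof (intro mult_mono 1 prod_mono)
      fix c assume "c \<in> {..<n} - {d}"
      then show "0 \<le> real (card (In c i)) ^ n \<and> real (card (In c i)) ^ n \<le> real (card (S c)) ^ n"
        using In[of c i] finS[of c] iT by (auto intro!: power_mono card_mono)
    qed (auto intro: prod_nonneg)
    also have "\<dots> = s"
      unfolding s_def using d prod.remove[of "{..<n}" d "\<lambda>c. real (card (S c)) ^ n"] by simp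
    finally show ?thesis .
  qed
  have "2 * M * (\<Sum>i\<in>Tb. ?r i) \<le> (\<Sum>i\<in>Tb. s)"
    unfolding sum_distrib_left using bad by (rule sum_mono)
  also have "\<dots> = real (card Tb) * s" by simp
  also have "\<dots> \<le> M * s"
  proof -
    have "card Tb \<le> card T" unfolding Tb_def using finT by (intro card_mono) auto
    then show ?thesis using cT s0 by (intro mult_right_mono) auto
  qed
  finally have "M * (2 * (\<Sum>i\<in>Tb. ?r i)) \<le> M * s" by (simp add: mult_ac)
  then have b: "2 * (\<Sum>i\<in>Tb. ?r i) \<le> s" using M by (subst (asm) mult_le_cancel_left_pos) auto
  have good: "?r i \<le> ?K ^ n * (\<Prod>c<n. real (mcount In c i i))" if "i \<in> T - Tb" for i
  proof -
    have "?r i \<le> (\<Prod>c<n. ?K * real (mcount In c i i))"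
    proof (intro prod_mono conjI)
      fix c assume "c \<in> {..<n}"
      then have c: "c < n" by simp
      have "card (In c i) \<ge> n ^ 4"
        using that c unfolding Tb_def by (metis (mono_tags, lifting) DiffE mem_Collect_eq not_less)
      moreover have "finite (In c i)" using that c finI by simp
      ultimately show "real (card (In c i)) ^ n \<le> ?K * real (mcount In c i i)"
        using two_row_tame_count[of "In c i" n "A i" "A i"] n_ge_2
        unfolding mcount_def common_def by simp
    qed auto
    then show ?thesis by (simp add: prod.distrib)
  qed
  have "(\<Sum>i\<in>T - Tb. ?r i) \<le> (\<Sum>i\<in>T - Tb. ?K ^ n * (\<Prod>c<n. real (mcount In c i i)))"
    by (rule sum_mono) (rule good)
  also have "\<dots> \<le> (\<Sum>i\<in>T. ?K ^ n * (\<Prod>c<n. real (mcount In c i i)))"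
    using finT by (intro sum_mono2) (auto intro!: mult_nonneg_nonneg prod_nonneg)
  also have "\<dots> = ?K ^ n * (\<Sum>i\<in>T. \<Prod>c<n. real (mcount In c i i))"
    by (simp add: sum_distrib_left)
  finally have g: "(\<Sum>i\<in>T - Tb. ?r i) \<le> ?K ^ n * (\<Sum>i\<in>T. \<Prod>c<n. real (mcount In c i i))" .
  have "(\<Sum>i\<in>T. ?r i) = (\<Sum>i\<in>T - Tb. ?r i) + (\<Sum>i\<in>Tb. ?r i)"
    using finT by (intro sum.subset_diff) (auto simp: Tb_def)
  then show ?thesis using b g \<Phi> by linarith
qed

text \<open>Row \<open>i\<close> becomes the lowest row of the block. Over all pairs the rise
  potential is at least 2H/G times the potential. Averaging finds a row that beats the share H/G
  with a surplus of s/M, and this surplus keeps every pool of row \<open>i\<close> from being too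
  small.\<close>

lemma choose_row:
  fixes T :: "nat set" and In :: "nat \<Rightarrow> nat \<Rightarrow> nat set" and M G H \<mu> :: real
  assumes finT: "finite T" and TR: "T \<subseteq> R" and cT: "real (card T) \<le> M"
    and finS: "\<And>c. c < n \<Longrightarrow> finite (S c)" and SC: "\<And>c. c < n \<Longrightarrow> S c \<subseteq> C"
    and In: "\<And>c i. c < n \<Longrightarrow> i \<in> T \<Longrightarrow> In c i \<subseteq> S c"
    and large: "\<And>c. c < n \<Longrightarrow> 2 * M * real n ^ (4 * n) \<le> real (card (S c)) ^ n"
    and M: "M \<ge> 1"
    and \<mu>: "\<mu> > 0" "8 * real (2 * n) ^ n * real n ^ (5 * n) * \<mu> = 1"
    and G: "G * \<mu> ^ (n\<^sup>2) = 64 * real (2 * n) ^ n * (real n ^ (5 * n)) ^ (2 * n)"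
    and HG: "H \<ge> G"
  defines "s \<equiv> \<Prod>c<n. real (card (S c)) ^ n"
  assumes \<Phi>: "H * s \<le> (\<Sum>i\<in>T. \<Prod>c<n. real (card (In c i)) ^ n)"
  shows "\<exists>i\<in>T. H / G * (\<Prod>c<n. real (card (In c i)) ^ n) \<le>
      (\<Sum>i'\<in>{i' \<in> T. i < i'}. \<Prod>c<n. real (card (rise In c i i')) ^ n) \<and>
    (\<forall>c<n. real (card (S c)) ^ n \<le> M\<^sup>2 * real (card (In c i)) ^ n)"
proof -
  let ?K = "real n ^ (5 * n)"
  let ?q = "real (2 * n) ^ n"
  let ?r = "\<lambda>i. \<Prod>c<n. real (card (In c i)) ^ n"
  let ?g = "\<lambda>i. \<Sum>i'\<in>{i' \<in> T. i < i'}. \<Prod>c<n. real (card (rise In c i i')) ^ n"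
  define F where "F = (\<Sum>i\<in>T. ?r i)"
  define D where "D = (\<Sum>i\<in>T. \<Prod>c<n. real (mcount In c i i))"
  have q1: "?q \<ge> 1" and K1: "?K \<ge> 1"
    using n_ge_2 by (intro one_le_power, simp)+
  have \<mu>1: "\<mu> \<le> 1"
  proof -
    have "\<mu> * 1 \<le> \<mu> * (8 * ?q * ?K)"
      using \<mu>(1) q1 K1 mult_mono[of 1 "8 * ?q" 1 ?K] by (intro mult_left_mono) auto
    then show ?thesis using \<mu>(2) by (simp add: mult_ac)
  qed
  have G64: "G \<ge> 64 * ?q * ?K ^ (2 * n)"
  proof -
    have "0 < \<mu> ^ (n\<^sup>2)" using \<mu>(1) by simp
    moreover have "0 \<le> 64 * ?q * ?K ^ (2 * n)" by simp
    ultimately have "G \<ge> 0" using G by (metis mult_neg_pos not_le)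
    then have "G * \<mu> ^ (n\<^sup>2) \<le> G * 1"
      using \<mu>1 \<mu>(1) by (intro mult_left_mono power_le_one) auto
    then show ?thesis using G by simp
  qed
  have Kn: "?K ^ n \<le> ?K ^ (2 * n)" using K1 by (intro power_increasing) auto
  have Kn1: "?K ^ n \<ge> 1" using K1 by (rule one_le_power)
  have qK: "1 \<le> ?q * ?K ^ n" using q1 Kn1 mult_mono[of 1 ?q 1 "?K ^ n"] by auto
  have "?q * ?K ^ n \<le> ?q * ?K ^ (2 * n)" using Kn q1 by (intro mult_left_mono) auto
  then have G4: "G \<ge> 4 * ?q * ?K ^ n" using G64 qK by linarith
  then have G1: "G \<ge> 1" using qK by linarith
  then have H1: "H \<ge> 1" using HG by linarith
  have spos: "real (card (S c)) ^ n > 0" if "c < n" for c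
  proof -
    have "0 < 2 * M * real n ^ (4 * n)" using M n_ge_2 by simp
    then show ?thesis using large[OF that] by linarith
  qed
  have s0: "s > 0" unfolding s_def using spos by (intro prod_pos) auto
  have F: "H * s \<le> F" using \<Phi> unfolding F_def .
  have "1 * s \<le> H * s" using H1 s0 by (intro mult_right_mono) auto
  then have sF: "s \<le> F" using F by linarith
  have FD: "F \<le> 2 * ?K ^ n * D"
    unfolding F_def D_def
    by (rule mcount_diag_sum_bound[where S = S and In = In and M = M, OF finT cT finS In large M
        sF[unfolded s_def F_def]])
  \<comment> \<open>Since \<mu> \<le> 1, \<open>G\<close> is at least 4 q K^n; this makes
    \<open>D\<close> large enough for \<open>rise_sum_bound\<close>.\<close>
  have big: "2 * ?q * s \<le> D"
  proof -
    have "?K ^ n * (4 * ?q * s) = (4 * ?q * ?K ^ n) * s" by simp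
    also have "\<dots> \<le> H * s" using G4 HG s0 by (intro mult_right_mono) auto
    also have "\<dots> \<le> ?K ^ n * (2 * D)" using F FD by (simp add: mult_ac)
    finally show ?thesis using Kn1 by (subst (asm) mult_le_cancel_left_pos) (auto simp: mult_ac)
  qed
  let ?W = "\<Sum>i\<in>T. ?g i"
  have W: "D\<^sup>2 * \<mu> ^ (n\<^sup>2) \<le> 8 * ?q * s * ?W"
  proof -
    have "{(i, i') \<in> T \<times> T. i < i'} = Sigma T (\<lambda>i. {i' \<in> T. i < i'})" by auto
    then have e: "(\<Sum>(i, i')\<in>{(i, i') \<in> T \<times> T. i < i'}. \<Prod>c<n. real (card (rise In c i i')) ^ n) = ?W"
      using finT by (simp add: sum.Sigma)
    show ?thesis
      using rise_sum_bound[where S = S and In = In, OF finT TR finS SC In \<mu> big[unfolded s_def D_def]]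
      unfolding e D_def s_def .
  qed
  \<comment> \<open>The 64 in \<open>G\<close> is 2 * 4 * 8, with 4 from squaring \<open>FD\<close>
    and 8 from \<open>W\<close>, so 2 F^2 \<le> G s W; one factor \<open>F\<close> is then replaced
    by its lower bound \<open>H * s\<close>.\<close>
  have W2: "2 * H / G * F \<le> ?W"
  proof -
    have F0: "F > 0" using sF s0 by linarith
    have "F\<^sup>2 \<le> (2 * ?K ^ n * D)\<^sup>2" using FD F0 by (intro power_mono) auto
    also have "\<dots> = 4 * ?K ^ (2 * n) * D\<^sup>2"
      by (simp add: power_mult_distrib power_mult[symmetric] mult.commute)
    finally have "F\<^sup>2 * \<mu> ^ (n\<^sup>2) \<le> 4 * ?K ^ (2 * n) * (D\<^sup>2 * \<mu> ^ (n\<^sup>2))"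
      using \<mu>(1) by (simp add: mult.assoc[symmetric])
    also have "\<dots> \<le> 4 * ?K ^ (2 * n) * (8 * ?q * s * ?W)"
      using W K1 by (intro mult_left_mono) auto
    finally have "2 * F\<^sup>2 * \<mu> ^ (n\<^sup>2) \<le> (64 * ?q * ?K ^ (2 * n)) * (s * ?W)"
      by (simp add: mult_ac)
    also have "\<dots> = (G * (s * ?W)) * \<mu> ^ (n\<^sup>2)" unfolding G[symmetric] by (simp add: mult_ac)
    finally have "2 * F\<^sup>2 \<le> G * (s * ?W)"
      using \<mu>(1) by (subst (asm) mult_le_cancel_right_pos) auto
    moreover have "(H * s) * F \<le> F * F" using F F0 by (intro mult_right_mono) auto
    ultimately have "s * (2 * H * F) \<le> s * (G * ?W)"
      by (simp add: power2_eq_square mult_ac)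
    then have "2 * H * F \<le> G * ?W" using s0 by (subst (asm) mult_le_cancel_left_pos) auto
    then show ?thesis using G1 by (simp add: field_simps)
  qed
  have HG1: "H / G \<ge> 1" using HG G1 by simp
  have Fs: "s \<le> H / G * F"
    using sF HG1 s0 mult_mono[of 1 "H / G" s F] by simp
  \<comment> \<open>If every row failed, summation would give W - (H/G) F < s \<le> (H/G) F,
    contradicting \<open>W2\<close>.\<close>
  have "\<exists>i\<in>T. s \<le> M * (?g i - H / G * ?r i)"
  proof (rule ccontr)
    assume "\<not> ?thesis"
    then have lt: "M * (?g i - H / G * ?r i) < s" if "i \<in> T" for i using that by (simp add: not_le)
    have e: "(\<Sum>i\<in>T. M * (?g i - H / G * ?r i)) = M * (?W - H / G * F)"
      unfolding F_def sum_distrib_left[symmetric] sum_subtractf ..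
    have "T \<noteq> {}" using sF s0 unfolding F_def by auto
    then have "(\<Sum>i\<in>T. M * (?g i - H / G * ?r i)) < (\<Sum>i\<in>T. s)"
      using finT lt by (intro sum_strict_mono) auto
    also have "\<dots> \<le> M * s" using cT s0 by simp
    finally have "M * (?W - H / G * F) < M * s" unfolding e .
    then have "?W - H / G * F < s" using M by (subst (asm) mult_less_cancel_left_pos) auto
    also have "\<dots> \<le> H / G * F" by (rule Fs)
    finally have "?W < 2 * (H / G * F)" by (simp only: mult_2 diff_less_eq)
    also have "\<dots> = 2 * H / G * F" by simp
    finally show False using W2 by (meson not_less)
  qed
  then obtain i where i: "i \<in> T" "s \<le> M * (?g i - H / G * ?r i)" by blast
  have r0: "?r i \<ge> 0" by (intro prod_nonneg) auto
  have "0 < M * (?g i - H / G * ?r i)" using i(2) s0 by linarith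
  then have gi: "H / G * ?r i \<le> ?g i" using M by (simp add: zero_less_mult_iff)
  have finI: "finite (In c i)" if "c < n" for c
    using In[OF that i(1)] finS[OF that] finite_subset by blast
  \<comment> \<open>Rise sets of row \<open>i\<close> lie in its own pools; this turns the surplus
    into s \<le> M^2 times the potential of row \<open>i\<close>.\<close>
  have gr: "?g i \<le> M * ?r i"
  proof -
    have "?g i \<le> (\<Sum>i'\<in>{i' \<in> T. i < i'}. ?r i)"
      using finI by (intro sum_mono prod_mono) (auto simp: rise_def intro!: power_mono card_mono)
    also have "\<dots> = real (card {i' \<in> T. i < i'}) * ?r i" by simp
    also have "\<dots> \<le> M * ?r i"
    proof (rule mult_right_mono[OF _ r0])
      have "card {i' \<in> T. i < i'} \<le> card T" using finT by (intro card_mono) auto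
      then show "real (card {i' \<in> T. i < i'}) \<le> M" using cT by linarith
    qed
    finally show ?thesis .
  qed
  have "0 \<le> H / G * ?r i" using r0 HG1 by (intro mult_nonneg_nonneg) linarith
  then have "M * (?g i - H / G * ?r i) \<le> M * ?g i"
    using M by (intro mult_left_mono) linarith+
  also have "\<dots> \<le> M * (M * ?r i)" using gr M by (intro mult_left_mono) auto
  finally have sM: "s \<le> M\<^sup>2 * ?r i" using i(2) by (simp add: power2_eq_square mult.assoc)
  \<comment> \<open>The other pools of row \<open>i\<close> are at most the full ones, so their
    product cancels and only pool \<open>d\<close> remains.\<close>
  have "real (card (S d)) ^ n \<le> M\<^sup>2 * real (card (In d i)) ^ n" if d: "d < n" for d
  proof -
    let ?o = "\<Prod>c\<in>{..<n} - {d}. real (card (S c)) ^ n"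
    have o: "?o > 0" using spos by (intro prod_pos) auto
    have "real (card (S d)) ^ n * ?o = s"
      unfolding s_def using d prod.remove[of "{..<n}" d "\<lambda>c. real (card (S c)) ^ n"] by simp
    also have "\<dots> \<le> M\<^sup>2 * ?r i" by (rule sM)
    also have "?r i = real (card (In d i)) ^ n * (\<Prod>c\<in>{..<n} - {d}. real (card (In c i)) ^ n)"
      using d prod.remove[of "{..<n}" d "\<lambda>c. real (card (In c i)) ^ n"] by simp
    also have "M\<^sup>2 * \<dots> \<le> M\<^sup>2 * (real (card (In d i)) ^ n * ?o)"
      using In finS i(1)
      by (intro mult_left_mono prod_mono) (auto intro!: power_mono card_mono)
    finally have "real (card (S d)) ^ n * ?o \<le> (M\<^sup>2 * real (card (In d i)) ^ n) * ?o" by simp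
    then show ?thesis using o by (subst (asm) mult_le_cancel_right_pos) auto
  qed
  then show ?thesis using i(1) gi by blast
qed

text \<open>Induction on \<open>k\<close>: \<open>choose_row\<close> fixes the lowest row
  \<open>i\<close>, the pools become \<open>In c i\<close>, and a later row \<open>i'\<close> keeps
  \<open>rise In c i i'\<close>. Each step costs a factor \<open>G\<close> of relative potential and
  M^2 in the n-th power of a pool size, hence G^k and M^(2k).\<close>

lemma rising_rows:
  fixes T :: "nat set" and In :: "nat \<Rightarrow> nat \<Rightarrow> nat set" and M G \<mu> :: real
  assumes M: "M \<ge> 1"
    and \<mu>: "\<mu> > 0" "8 * real (2 * n) ^ n * real n ^ (5 * n) * \<mu> = 1"
    and G: "G * \<mu> ^ (n\<^sup>2) = 64 * real (2 * n) ^ n * (real n ^ (5 * n)) ^ (2 * n)" "G \<ge> 1"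
  shows "finite T \<Longrightarrow> T \<subseteq> R \<Longrightarrow> real (card T) \<le> M \<Longrightarrow>
    (\<And>c. c < n \<Longrightarrow> finite (S c)) \<Longrightarrow> (\<And>c. c < n \<Longrightarrow> S c \<subseteq> C) \<Longrightarrow>
    (\<And>c i. c < n \<Longrightarrow> i \<in> T \<Longrightarrow> In c i \<subseteq> S c) \<Longrightarrow>
    (\<And>c. c < n \<Longrightarrow> 2 * M * real n ^ (4 * n) * M ^ (2 * k) \<le> real (card (S c)) ^ n) \<Longrightarrow>
    G ^ k * (\<Prod>c<n. real (card (S c)) ^ n) \<le> (\<Sum>i\<in>T. \<Prod>c<n. real (card (In c i)) ^ n) \<Longrightarrow>
    \<exists>I y. I \<subseteq> T \<and> card I = Suc k \<and> (\<forall>c<n. \<forall>i\<in>I. y c \<in> In c i) \<and>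
      (\<forall>c<n. \<forall>i\<in>I. \<forall>i'\<in>I. i < i' \<longrightarrow> A i (y c) < A i' (y c))"
proof (induction k arbitrary: T S In)
  case 0
  \<comment> \<open>A nonzero potential yields a row with a column left in every pool.\<close>
  have "real (card (S c)) ^ n > 0" if "c < n" for c
  proof -
    have "0 < 2 * M * real n ^ (4 * n)" using M n_ge_2 by simp
    also have "\<dots> \<le> real (card (S c)) ^ n" using 0(7)[OF that] by simp
    finally show ?thesis .
  qed
  then have "(\<Prod>c<n. real (card (S c)) ^ n) > 0" by (intro prod_pos) auto
  then have "(\<Sum>i\<in>T. \<Prod>c<n. real (card (In c i)) ^ n) \<noteq> 0" using 0(8) by simp
  then obtain i where i: "i \<in> T" "(\<Prod>c<n. real (card (In c i)) ^ n) \<noteq> 0"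
    by (meson sum.not_neutral_contains_not_neutral)
  have "In c i \<noteq> {}" if "c < n" for c
  proof
    assume "In c i = {}"
    then have "\<exists>c\<in>{..<n}. real (card (In c i)) ^ n = 0" using n_ge_2 that by (intro bexI[of _ c]) auto
    then show False using i(2) by simp
  qed
  then have "\<forall>c\<in>{..<n}. \<exists>j. j \<in> In c i" by auto
  then obtain y where "\<forall>c\<in>{..<n}. y c \<in> In c i" unfolding bchoice_iff by blast
  then show ?case using i(1) by (intro exI[of _ "{i}"] exI[of _ y]) auto
next
  case (Suc k)
  have MM: "1 \<le> M ^ (2 * Suc k)" using M by (rule one_le_power)
  have large: "2 * M * real n ^ (4 * n) \<le> real (card (S c)) ^ n" if "c < n" for c
  proof -
    have "2 * M * real n ^ (4 * n) * 1 \<le> 2 * M * real n ^ (4 * n) * M ^ (2 * Suc k)"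
      using MM M by (intro mult_left_mono) auto
    then show ?thesis using Suc.prems(7)[OF that] by linarith
  qed
  have HG: "G \<le> G ^ Suc k" using G(2) by (simp add: mult_left_le one_le_power)
  have "\<exists>i\<in>T. G ^ Suc k / G * (\<Prod>c<n. real (card (In c i)) ^ n) \<le>
      (\<Sum>i'\<in>{i' \<in> T. i < i'}. \<Prod>c<n. real (card (rise In c i i')) ^ n) \<and>
    (\<forall>c<n. real (card (S c)) ^ n \<le> M\<^sup>2 * real (card (In c i)) ^ n)"
    by (rule choose_row[where S = S and In = In, OF Suc.prems(1-6) large M \<mu> G(1) HG Suc.prems(8)])
  then obtain i where i: "i \<in> T"
    "G ^ k * (\<Prod>c<n. real (card (In c i)) ^ n) \<le>
      (\<Sum>i'\<in>{i' \<in> T. i < i'}. \<Prod>c<n. real (card (rise In c i i')) ^ n)"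
    "\<And>c. c < n \<Longrightarrow> real (card (S c)) ^ n \<le> M\<^sup>2 * real (card (In c i)) ^ n"
    using G(2) by auto
  let ?T = "{i' \<in> T. i < i'}"
  have "\<exists>I y. I \<subseteq> ?T \<and> card I = Suc k \<and> (\<forall>c<n. \<forall>i'\<in>I. y c \<in> rise In c i i') \<and>
      (\<forall>c<n. \<forall>i\<in>I. \<forall>i'\<in>I. i < i' \<longrightarrow> A i (y c) < A i' (y c))"
  proof (rule Suc.IH[of ?T "\<lambda>c. In c i" "\<lambda>c i'. rise In c i i'"])
    show "finite ?T" "?T \<subseteq> R" using Suc.prems by auto
    have "card ?T \<le> card T" using Suc.prems(1) by (intro card_mono) auto
    then show "real (card ?T) \<le> M" using Suc.prems(3) by linarith
    show "finite (In c i)" if "c < n" for c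
      using Suc.prems(6)[OF that i(1)] Suc.prems(4)[OF that] finite_subset by blast
    show "In c i \<subseteq> C" if "c < n" for c
      using Suc.prems(6)[OF that i(1)] Suc.prems(5)[OF that] by blast
    show "rise In c i i' \<subseteq> In c i" for c i' unfolding rise_def by auto
    show "2 * M * real n ^ (4 * n) * M ^ (2 * k) \<le> real (card (In c i)) ^ n" if c: "c < n" for c
    proof -
      have "M\<^sup>2 * (2 * M * real n ^ (4 * n) * M ^ (2 * k)) = 2 * M * real n ^ (4 * n) * M ^ (2 * Suc k)"
        by (simp add: power_add power2_eq_square mult_ac)
      also have "\<dots> \<le> M\<^sup>2 * real (card (In c i)) ^ n"
        using Suc.prems(7)[OF c] i(3)[OF c] by linarith
      finally show ?thesis using M by (subst (asm) mult_le_cancel_left_pos) auto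
    qed
  qed (rule i(2))
  then obtain I y where I: "I \<subseteq> ?T" "card I = Suc k" "\<forall>c<n. \<forall>i'\<in>I. y c \<in> rise In c i i'"
      "\<forall>c<n. \<forall>i\<in>I. \<forall>i'\<in>I. i < i' \<longrightarrow> A i (y c) < A i' (y c)"
    by (elim exE conjE) (rule that)
  \<comment> \<open>Some later row exists, and its rise sets lie in \<open>In c i\<close>; so
    \<open>y c\<close> is available to row \<open>i\<close> as well.\<close>
  have "I \<noteq> {}" using I(2) by auto
  then obtain i0 where i0: "i0 \<in> I" by blast
  have "finite I" using I(1) Suc.prems(1) by (auto intro: finite_subset)
  moreover have "i \<notin> I" using I(1) by auto
  ultimately have "card (insert i I) = Suc (Suc k)" using I(2) by simp
  moreover have "y c \<in> In c i'" if "c < n" "i' \<in> insert i I" for c i'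
    using I(3) that i0 unfolding rise_def by auto
  moreover have "A i1 (y c) < A i2 (y c)"
    if "c < n" "i1 \<in> insert i I" "i2 \<in> insert i I" "i1 < i2" for c i1 i2
    using that I(1) I(3) I(4) unfolding rise_def by fastforce
  ultimately show ?case using I(1) i(1) by (intro exI[of _ "insert i I"] exI[of _ y]) auto
qed

end

subsection \<open>Column pools ordered by value\<close>

text \<open>Greedy choice: take the least \<theta> for which some \<open>B b\<close> has
  \<open>t\<close> elements of value at most \<theta>, give \<open>t\<close> of them to
  \<open>b\<close>, and drop from the other sets everything below \<theta>. Each round costs at most
  \<open>t\<close> elements per set. \<open>\<sigma>\<close> ranks the sets by value.\<close>

lemma separated_subsets:
  fixes B :: "nat \<Rightarrow> nat set" and v :: "nat \<Rightarrow> real"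
  assumes "finite Q" "t \<ge> 1"
    and "\<And>a. a \<in> Q \<Longrightarrow> finite (B a) \<and> card Q * t \<le> card (B a)"
  shows "\<exists>D \<sigma>. (\<forall>a\<in>Q. D a \<subseteq> B a \<and> card (D a) = t) \<and> inj_on \<sigma> Q \<and>
    (\<forall>a\<in>Q. \<forall>a'\<in>Q. (\<sigma> a :: nat) < \<sigma> a' \<longrightarrow> (\<forall>x\<in>D a. \<forall>y\<in>D a'. v x \<le> v y))"
  using assms
proof (induction "card Q" arbitrary: Q B)
  case 0
  then show ?case by auto
next
  case (Suc k)
  define \<Theta> where "\<Theta> = (\<Union>a\<in>Q. {\<theta> \<in> v ` B a. t \<le> card {x \<in> B a. v x \<le> \<theta>}})"
  have fin\<Theta>: "finite \<Theta>" unfolding \<Theta>_def using Suc.prems by auto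
  have t_le: "t \<le> card (B a)" if "a \<in> Q" for a
    using Suc.prems(3)[OF that] Suc.hyps(2) by (metis add_leD1 mult_Suc)
  obtain a0 where a0: "a0 \<in> Q" using Suc.hyps(2) by fastforce
  have ne: "B a0 \<noteq> {}" using t_le[OF a0] Suc.prems(2) by auto
  have "{x \<in> B a0. v x \<le> Max (v ` B a0)} = B a0" using Suc.prems(3)[OF a0] by auto
  moreover have "Max (v ` B a0) \<in> v ` B a0" using Suc.prems(3)[OF a0] ne by (intro Max_in) auto
  ultimately have "Max (v ` B a0) \<in> \<Theta>" unfolding \<Theta>_def using a0 t_le by auto
  then have "Min \<Theta> \<in> \<Theta>" using fin\<Theta> by (intro Min_in) auto
  define \<theta> where "\<theta> = Min \<Theta>"
  obtain b where b: "b \<in> Q" "t \<le> card {x \<in> B b. v x \<le> \<theta>}"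
  proof -
    have "\<theta> \<in> \<Theta>" unfolding \<theta>_def by fact
    then show thesis unfolding \<Theta>_def using that by blast
  qed
  obtain D0 where D0: "D0 \<subseteq> {x \<in> B b. v x \<le> \<theta>}" "card D0 = t"
    using b(2) by (meson obtain_subset_with_card_n)
  \<comment> \<open>Otherwise the largest value below \<theta> in \<open>B a\<close> would be a
    smaller member of \<Theta>.\<close>
  have low: "card {x \<in> B a. v x < \<theta>} \<le> t" if a: "a \<in> Q" for a
  proof (rule ccontr)
    let ?L = "{x \<in> B a. v x < \<theta>}"
    assume "\<not> card ?L \<le> t"
    then have L: "t \<le> card ?L" "?L \<noteq> {}" by (auto simp del: Collect_empty_eq)
    have finL: "finite ?L" using Suc.prems(3)[OF a] by simp
    let ?m = "Max (v ` ?L)"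
    have m: "?m \<in> v ` ?L" using finL L(2) by (intro Max_in) auto
    have "?L \<subseteq> {x \<in> B a. v x \<le> ?m}" using finL by auto
    then have "card ?L \<le> card {x \<in> B a. v x \<le> ?m}" using Suc.prems(3)[OF a] by (intro card_mono) auto
    then have "?m \<in> \<Theta>" unfolding \<Theta>_def using a m L(1) by auto
    then have "\<theta> \<le> ?m" unfolding \<theta>_def using fin\<Theta> by simp
    then show False using m by auto
  qed
  define B' where "B' = (\<lambda>a. {x \<in> B a. \<theta> \<le> v x})"
  let ?Q = "Q - {b}"
  have kQ: "k = card ?Q" using Suc.hyps(2) b(1) Suc.prems(1) by simp
  have IH: "\<exists>D \<sigma>. (\<forall>a\<in>?Q. D a \<subseteq> B' a \<and> card (D a) = t) \<and> inj_on \<sigma> ?Q \<and>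
    (\<forall>a\<in>?Q. \<forall>a'\<in>?Q. (\<sigma> a :: nat) < \<sigma> a' \<longrightarrow> (\<forall>x\<in>D a. \<forall>y\<in>D a'. v x \<le> v y))"
  proof (rule Suc.hyps(1)[OF kQ])
    show "finite ?Q" "1 \<le> t" using Suc.prems by auto
    fix a assume a: "a \<in> ?Q"
    have fa: "finite (B a)" and ca: "Suc k * t \<le> card (B a)"
      using Suc.prems(3)[of a] a Suc.hyps(2) by auto
    have "B a = B' a \<union> {x \<in> B a. v x < \<theta>}" unfolding B'_def by auto
    then have "card (B a) \<le> card (B' a) + card {x \<in> B a. v x < \<theta>}" by (metis card_Un_le)
    moreover have "card {x \<in> B a. v x < \<theta>} \<le> t" using low a by simp
    ultimately show "finite (B' a) \<and> card ?Q * t \<le> card (B' a)"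
      using fa ca kQ unfolding B'_def by auto
  qed
  then obtain D \<sigma> where D\<sigma>: "\<forall>a\<in>?Q. D a \<subseteq> B' a \<and> card (D a) = t" "inj_on \<sigma> ?Q"
    "\<forall>a\<in>?Q. \<forall>a'\<in>?Q. (\<sigma> a :: nat) < \<sigma> a' \<longrightarrow> (\<forall>x\<in>D a. \<forall>y\<in>D a'. v x \<le> v y)"
    by (elim exE conjE) (rule that)
  note D = D\<sigma>(1)[rule_format] D\<sigma>(2) D\<sigma>(3)[rule_format]
  \<comment> \<open>\<open>b\<close> takes rank 0 and the remaining ranks move up by one.\<close>
  let ?D = "D(b := D0)" and ?\<sigma> = "\<lambda>a. if a = b then 0 else Suc (\<sigma> a)"
  have "?D a \<subseteq> B a \<and> card (?D a) = t" if "a \<in> Q" for a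
    using D(1)[of a] D0 that unfolding B'_def by (cases "a = b") auto
  moreover have "inj_on ?\<sigma> Q"
  proof (rule inj_onI)
    fix a a' assume "a \<in> Q" "a' \<in> Q" "?\<sigma> a = ?\<sigma> a'"
    then show "a = a'" using inj_onD[OF D(2), of a a'] by (cases "a = b"; cases "a' = b") simp_all
  qed
  moreover have "v x \<le> v y" if "a \<in> Q" "a' \<in> Q" "?\<sigma> a < ?\<sigma> a'" "x \<in> ?D a" "y \<in> ?D a'" for a a' x y
  proof (cases "a = b")
    case True
    then have "a' \<noteq> b" using that(3) by auto
    then have "\<theta> \<le> v y" using D(1)[of a'] that unfolding B'_def by auto
    moreover have "v x \<le> \<theta>" using D0 that True by auto
    ultimately show ?thesis by linarith
  next
    case False
    then have "a' \<noteq> b" "\<sigma> a < \<sigma> a'" using that(3) by (auto split: if_splits)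
    then show ?thesis using D(3)[of a a' x y] that False by auto
  qed
  ultimately show ?case by (intro exI[of _ ?D] exI[of _ ?\<sigma>] conjI ballI impI) simp_all
qed

text \<open>\<open>separated_subsets\<close> ranks the n^2 pools by value; Erdos-Szekeres on the
  ranks selects n pools along which they are monotone, in the direction \<open>up\<close>.\<close>

lemma monotone_pools:
  fixes B :: "nat \<Rightarrow> nat set" and v :: "nat \<Rightarrow> real"
  assumes n: "n \<ge> 1" and t: "t \<ge> 1"
    and B: "\<And>a. a < n\<^sup>2 \<Longrightarrow> finite (B a) \<and> n\<^sup>2 * t \<le> card (B a)"
  shows "\<exists>Q D up. Q \<in> nsub n {..<n\<^sup>2} \<and> (\<forall>a\<in>Q. D a \<subseteq> B a \<and> card (D a) = t) \<and>
    (\<forall>a\<in>Q. \<forall>a'\<in>Q. a < a' \<longrightarrow> (\<forall>x\<in>D a. \<forall>y\<in>D a'. if up then v x \<le> v y else v y \<le> v x))"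
proof -
  have "\<exists>D \<sigma>. (\<forall>a\<in>{..<n\<^sup>2}. D a \<subseteq> B a \<and> card (D a) = t) \<and> inj_on \<sigma> {..<n\<^sup>2} \<and>
    (\<forall>a\<in>{..<n\<^sup>2}. \<forall>a'\<in>{..<n\<^sup>2}. (\<sigma> a :: nat) < \<sigma> a' \<longrightarrow> (\<forall>x\<in>D a. \<forall>y\<in>D a'. v x \<le> v y))"
    using B by (intro separated_subsets[OF _ t]) auto
  then obtain D \<sigma> where D\<sigma>: "\<forall>a\<in>{..<n\<^sup>2}. D a \<subseteq> B a \<and> card (D a) = t" "inj_on \<sigma> {..<n\<^sup>2}"
    "\<forall>a\<in>{..<n\<^sup>2}. \<forall>a'\<in>{..<n\<^sup>2}. (\<sigma> a :: nat) < \<sigma> a' \<longrightarrow> (\<forall>x\<in>D a. \<forall>y\<in>D a'. v x \<le> v y)"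
    by (elim exE conjE) (rule that)
  note D = D\<sigma>(1)[rule_format, unfolded lessThan_iff] D\<sigma>(2) D\<sigma>(3)[rule_format, unfolded lessThan_iff]
  have "(n - 1)\<^sup>2 < n\<^sup>2" using n by (intro power_strict_mono) auto
  then obtain Q where Q: "Q \<subseteq> {..<n\<^sup>2}" "card Q = n" "tame (\<lambda>a. real (\<sigma> a)) Q"
    using erdos_szekeres[of "{..<n\<^sup>2}" n "\<lambda>a. real (\<sigma> a)"] n by auto
  define up where "up \<longleftrightarrow> mono_on Q (\<lambda>a. real (\<sigma> a))"
  have "if up then v x \<le> v y else v y \<le> v x"
    if "a \<in> Q" "a' \<in> Q" "a < a'" "x \<in> D a" "y \<in> D a'" for a a' x y
  proof -
    have m: "a < n\<^sup>2" "a' < n\<^sup>2" using that Q(1) by auto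
    have ne: "\<sigma> a \<noteq> \<sigma> a'" using D(2) m that(3) unfolding inj_on_def by auto
    show ?thesis
    proof (cases up)
      case True
      then have "\<sigma> a \<le> \<sigma> a'" using that unfolding up_def monotone_on_def by auto
      then show ?thesis using D(3)[OF m] ne that True by auto
    next
      case False
      then have "antimono_on Q (\<lambda>a. real (\<sigma> a))" using Q(3) unfolding up_def tame_def by auto
      then have "\<sigma> a' \<le> \<sigma> a" using that unfolding monotone_on_def by auto
      then show ?thesis using D(3)[OF m(2) m(1)] ne that False by auto
    qed
  qed
  moreover have "D a \<subseteq> B a \<and> card (D a) = t" if "a \<in> Q" for a
    using D(1)[of a] Q(1) that by blast
  moreover have "Q \<in> nsub n {..<n\<^sup>2}" using Q by (simp add: nsub_def)
  ultimately show ?thesis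
    by (intro exI[of _ Q] exI[of _ D] exI[of _ up] conjI ballI impI) simp_all
qed

section \<open>Choice of parameters and assembly of the block\<close>

lemma fibre_ge_average:
  assumes fin: "finite B" "finite C" and g: "g ` B \<subseteq> C" and B: "B \<noteq> {}"
  shows "\<exists>z\<in>C. card B \<le> card C * card {x \<in> B. g x = z}"
proof (rule ccontr)
  assume "\<not> ?thesis"
  then have lt: "card C * card {x \<in> B. g x = z} < card B" if "z \<in> C" for z using that by (simp add: not_le)
  have C: "C \<noteq> {}" using g B by auto
  have "card B = card (\<Union>z\<in>C. {x \<in> B. g x = z})" using g by (intro arg_cong[where f = card]) auto
  also have "\<dots> \<le> (\<Sum>z\<in>C. card {x \<in> B. g x = z})" by (rule card_UN_le[OF fin(2)])
  finally have "card C * card B \<le> (\<Sum>z\<in>C. card C * card {x \<in> B. g x = z})"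
    by (simp add: sum_distrib_left[symmetric])
  also have "\<dots> < (\<Sum>z\<in>C. card B)" using lt C fin(2) by (intro sum_strict_mono) auto
  finally show False by simp
qed

text \<open>In one step of \<open>rising_rows\<close> the potential, relative to the size of the pools, drops by at
  most the factor \<open>gain n\<close>. The other factors of \<open>rows_needed n\<close> pay for fixing the chosen pools and
  the direction of the rows, and for the density \<open>1 / n\<^sup>2\<close> of the shrunken pools.\<close>

definition gain :: "nat \<Rightarrow> nat" where
  "gain n = 64 * (2 * n) ^ n * (n ^ (5 * n)) ^ (2 * n) * (8 * (2 * n) ^ n * n ^ (5 * n)) ^ (n\<^sup>2)"

definition rows_needed :: "nat \<Rightarrow> nat" where
  "rows_needed n = 2 * (n\<^sup>2) ^ n * (n\<^sup>2) ^ (n\<^sup>2) * gain n ^ n"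

text \<open>n^2 pools, each n^2 times the shrunken size M^2 n^4, where M is
  \<open>rows_needed n\<close>. The n-th power of the shrunken size is M^(2n) n^(4n), enough for the
  pool sizes in \<open>rising_rows\<close>.\<close>

definition size_needed :: "nat \<Rightarrow> nat" where
  "size_needed n = n\<^sup>2 * (n\<^sup>2 * ((rows_needed n)\<^sup>2 * n ^ 4))"

lemma exists_mono_block:
  fixes A :: "nat \<Rightarrow> nat \<Rightarrow> real"
  assumes n: "n \<ge> 2"
  shows "\<exists>I J. I \<subseteq> {..<rows_needed n} \<and> card I = n \<and> J \<subseteq> {..<size_needed n} \<and> card J = n \<and>
    mono_block A I J"
proof (rule ccontr)
  define M where "M = rows_needed n"
  define G where "G = gain n"
  define t where "t = M\<^sup>2 * n ^ 4"
  define b where "b = n\<^sup>2 * t"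
  assume "\<not> ?thesis"
  then interpret no_mono_block A n "{..<M}" "{..<n\<^sup>2 * b}"
    using n unfolding M_def b_def t_def size_needed_def by unfold_locales auto
  have G1: "G \<ge> 1" unfolding G_def gain_def using n by simp
  have M2: "M \<ge> 2" unfolding M_def rows_needed_def using n G1[unfolded G_def] by simp
  have t1: "t \<ge> 1" unfolding t_def using M2 n by simp
  \<comment> \<open>Consecutive intervals, so columns from different pools are ordered like the
    pools.\<close>
  define B where "B = (\<lambda>a. {a * b..<Suc a * b})"
  have cardB: "card (B a) = b" for a unfolding B_def by simp
  have B_less: "x < y" if "a < a'" "x \<in> B a" "y \<in> B a'" for a a' x y
  proof -
    have "x < Suc a * b" "a' * b \<le> y" using that unfolding B_def by auto
    moreover have "Suc a * b \<le> a' * b" using that(1) by (intro mult_right_mono) auto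
    ultimately show ?thesis by linarith
  qed
  have B_sub: "B a \<subseteq> {..<n\<^sup>2 * b}" if "a < n\<^sup>2" for a
  proof -
    have "Suc a * b \<le> n\<^sup>2 * b" using that by (intro mult_right_mono) auto
    then show ?thesis unfolding B_def by auto
  qed
  have "\<forall>i. \<exists>Q D up. Q \<in> nsub n {..<n\<^sup>2} \<and> (\<forall>a\<in>Q. D a \<subseteq> B a \<and> card (D a) = t) \<and>
    (\<forall>a\<in>Q. \<forall>a'\<in>Q. a < a' \<longrightarrow> (\<forall>x\<in>D a. \<forall>y\<in>D a'. if up then A i x \<le> A i y else A i y \<le> A i x))"
    using n t1 cardB unfolding b_def[symmetric]
    by (intro allI monotone_pools) (auto simp: b_def B_def)
  then obtain Q D up where QD: "\<And>i. Q i \<in> nsub n {..<n\<^sup>2}"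
    "\<And>i a. a \<in> Q i \<Longrightarrow> D i a \<subseteq> B a \<and> card (D i a) = t"
    "\<And>i a a' x y. a \<in> Q i \<Longrightarrow> a' \<in> Q i \<Longrightarrow> a < a' \<Longrightarrow> x \<in> D i a \<Longrightarrow> y \<in> D i a' \<Longrightarrow>
      if up i then A i x \<le> A i y else A i y \<le> A i x"
    by metis
  let ?C = "nsub n {..<n\<^sup>2} \<times> (UNIV :: bool set)"
  have finC: "finite ?C" using finite_nsub[of "{..<n\<^sup>2}"] by simp
  \<comment> \<open>Pigeonhole over at most 2 (n^2)^n combinations of selected pools and
    direction.\<close>
  have "\<exists>z\<in>?C. card {..<M} \<le> card ?C * card {i \<in> {..<M}. (Q i, up i) = z}"
  proof (intro fibre_ge_average finC)
    have "0 \<in> {..<M}" using M2 by simp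
    then show "{..<M} \<noteq> {}" by blast
  qed (use QD(1) in auto)
  then obtain Q0 u0 where Q0: "Q0 \<in> nsub n {..<n\<^sup>2}"
    "M \<le> card ?C * card {i \<in> {..<M}. (Q i, up i) = (Q0, u0)}"
    by auto
  define T where "T = {i \<in> {..<M}. (Q i, up i) = (Q0, u0)}"
  have TQ: "Q i = Q0" "up i = u0" if "i \<in> T" for i using that unfolding T_def by auto
  have "card (nsub n {..<n\<^sup>2}) \<le> (n\<^sup>2) ^ n" using card_nsub_le[of "{..<n\<^sup>2}" n] by simp
  then have "card ?C \<le> 2 * (n\<^sup>2) ^ n" by (simp add: card_cartesian_product)
  then have "M \<le> 2 * (n\<^sup>2) ^ n * card T"
    using Q0(2) unfolding T_def by (meson le_trans mult_le_mono1)
  then have "2 * (n\<^sup>2) ^ n * ((n\<^sup>2) ^ (n\<^sup>2) * G ^ n) \<le> 2 * (n\<^sup>2) ^ n * card T"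
    unfolding M_def rows_needed_def G_def by (simp add: mult_ac)
  then have cT: "(n\<^sup>2) ^ (n\<^sup>2) * G ^ n \<le> card T" using n by simp
  have cardQ0: "card Q0 = n" using Q0(1) by (simp add: nsub_def)
  have pick_in: "pick Q0 c \<in> Q0" if "c < n" for c using that cardQ0 by (intro pick_in_set_le) auto
  have pick_less: "pick Q0 c < pick Q0 c'" if "c < c'" "c' < n" for c c'
    using that cardQ0 by (intro pick_mono_le) auto
  have pick_n: "pick Q0 c < n\<^sup>2" if "c < n" for c
    using pick_in[OF that] Q0(1) by (auto simp: nsub_def)
  \<comment> \<open>The reference pools are the full intervals, common to all rows; the shrunken
    ones depend on the row and have density 1/n^2.\<close>
  define S where "S = (\<lambda>c. B (pick Q0 c))"
  define In where "In = (\<lambda>c i. D i (pick Q0 c))"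
  \<comment> \<open>With this value \<mu>^(n^2) cancels the last factor of
    \<open>gain n\<close>.\<close>
  define \<mu> where "\<mu> = 1 / (8 * real (2 * n) ^ n * real n ^ (5 * n))"
  have \<mu>: "\<mu> > 0" "8 * real (2 * n) ^ n * real n ^ (5 * n) * \<mu> = 1"
    unfolding \<mu>_def using n by auto
  have G\<mu>: "real G * \<mu> ^ (n\<^sup>2) = 64 * real (2 * n) ^ n * (real n ^ (5 * n)) ^ (2 * n)"
  proof -
    have "real G * \<mu> ^ (n\<^sup>2) = 64 * real (2 * n) ^ n * (real n ^ (5 * n)) ^ (2 * n) *
        ((8 * real (2 * n) ^ n * real n ^ (5 * n)) * \<mu>) ^ (n\<^sup>2)"
      unfolding G_def gain_def power_mult_distrib[of "8 * real (2 * n) ^ n * real n ^ (5 * n)" \<mu>] by simp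
    then show ?thesis unfolding \<mu>(2) by simp
  qed
  have In_S: "In c i \<subseteq> S c" "card (In c i) = t" if "c < n" "i \<in> T" for c i
    using QD(2)[of "pick Q0 c" i] pick_in[OF that(1)] TQ[OF that(2)] unfolding In_def S_def by auto
  have "\<exists>I y. I \<subseteq> T \<and> card I = Suc (n - 1) \<and> (\<forall>c<n. \<forall>i\<in>I. y c \<in> In c i) \<and>
      (\<forall>c<n. \<forall>i\<in>I. \<forall>i'\<in>I. i < i' \<longrightarrow> A i (y c) < A i' (y c))"
  proof (rule rising_rows[of "real M" \<mu> "real G" T S In "n - 1", OF _ \<mu> G\<mu>])
    show "1 \<le> real M" "1 \<le> real G" using M2 G1 by auto
    show "finite T" "T \<subseteq> {..<M}" unfolding T_def by auto
    then show "real (card T) \<le> real M" using card_mono[of "{..<M}" T] by simp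
    show "finite (S c)" "S c \<subseteq> {..<n\<^sup>2 * b}" if "c < n" for c
      using B_sub[OF pick_n[OF that]] unfolding S_def B_def by auto
    show "In c i \<subseteq> S c" if "c < n" "i \<in> T" for c i using In_S that by auto
    show "2 * real M * real n ^ (4 * n) * real M ^ (2 * (n - 1)) \<le> real (card (S c)) ^ n" for c
    proof -
      have e: "2 * n = Suc (Suc (2 * (n - 1)))" using n by simp
      \<comment> \<open>\<open>M \<ge> 2\<close> lets M^2 absorb the factor 2M.\<close>
      have "2 * M * M ^ (2 * (n - 1)) \<le> M ^ (2 * n)"
        unfolding e using M2 by simp
      then have "2 * M * n ^ (4 * n) * M ^ (2 * (n - 1)) \<le> M ^ (2 * n) * n ^ (4 * n)"
        using mult_le_mono1[of "2 * M * M ^ (2 * (n - 1))" "M ^ (2 * n)" "n ^ (4 * n)"]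
        by (simp only: mult_ac)
      also have "\<dots> = t ^ n" unfolding t_def by (simp add: power_mult_distrib power_mult)
      also have "\<dots> \<le> b ^ n" unfolding b_def using n by (intro power_mono) auto
      finally show ?thesis
        unfolding S_def cardB by (metis (mono_tags, lifting) of_nat_le_iff of_nat_mult of_nat_numeral of_nat_power)
    qed
    \<comment> \<open>n pools of density 1/n^2, each to the n-th power, cost (n^2)^(n^2);
      \<open>cT\<close> supplies this many rows times G^n.\<close>
    have "real G ^ (n - 1) * (\<Prod>c<n. real (card (S c)) ^ n) = real (G ^ (n - 1) * b ^ (n * n))"
      unfolding S_def cardB by (simp add: power_mult)
    also have "\<dots> = real (G ^ (n - 1) * (n\<^sup>2) ^ (n\<^sup>2) * t ^ (n * n))"
      unfolding b_def by (simp add: power_mult_distrib power2_eq_square)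
    also have "\<dots> \<le> real (card T * t ^ (n * n))"
    proof -
      have "G ^ (n - 1) \<le> G ^ n" using G1 by (intro power_increasing) auto
      then have "G ^ (n - 1) * (n\<^sup>2) ^ (n\<^sup>2) \<le> G ^ n * (n\<^sup>2) ^ (n\<^sup>2)" by (rule mult_le_mono1)
      then have "G ^ (n - 1) * (n\<^sup>2) ^ (n\<^sup>2) \<le> card T" using cT by (metis mult.commute order_trans)
      then show ?thesis by (intro of_nat_mono mult_le_mono1)
    qed
    also have "\<dots> = (\<Sum>i\<in>T. \<Prod>c<n. real (card (In c i)) ^ n)"
      using In_S(2) by (simp add: power_mult)
    finally show "real G ^ (n - 1) * (\<Prod>c<n. real (card (S c)) ^ n) \<le>
      (\<Sum>i\<in>T. \<Prod>c<n. real (card (In c i)) ^ n)" .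
  qed
  then obtain I y where Iy: "I \<subseteq> T" "card I = Suc (n - 1)" "\<forall>c<n. \<forall>i\<in>I. y c \<in> In c i"
      "\<forall>c<n. \<forall>i\<in>I. \<forall>i'\<in>I. i < i' \<longrightarrow> A i (y c) < A i' (y c)"
    by (elim exE conjE) (rule that)
  have "card I = n" using Iy(2) n by simp
  note I = Iy(1) this Iy(3)[rule_format] Iy(4)[rule_format]
  obtain i0 where i0: "i0 \<in> I" using I(2) n by fastforce
  have yS: "y c \<in> S c" if "c < n" for c using I(1) I(3)[OF that i0] In_S(1)[OF that] i0 by auto
  have y_less: "y c < y c'" if "c < c'" "c' < n" for c c'
    using B_less[OF pick_less[OF that]] yS that unfolding S_def by auto
  have "inj_on y {..<n}" unfolding inj_on_def using y_less by (metis lessThan_iff nat_neq_iff)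
  then have cJ: "card (y ` {..<n}) = n" by (simp add: card_image)
  have JC: "y ` {..<n} \<subseteq> {..<n\<^sup>2 * b}" using yS B_sub pick_n unfolding S_def by blast
  \<comment> \<open>\<open>y c\<close> lies in the shrunken pool of each chosen row, so monotonicity
    across the pools passes to the columns \<open>y c\<close>, with common direction
    \<open>u0\<close>.\<close>
  have row: "if u0 then A i j \<le> A i j' else A i j' \<le> A i j"
    if h: "i \<in> I" "j \<in> y ` {..<n}" "j' \<in> y ` {..<n}" "j < j'" for i j j'
  proof -
    obtain c c' where c: "c < n" "c' < n" "j = y c" "j' = y c'" using h by auto
    have "c < c'" using y_less[of c' c] c h(4) by (metis nat_neq_iff order_less_asym)
    have iT: "i \<in> T" using I(1) h(1) by auto
    have "y c \<in> D i (pick Q0 c)" "y c' \<in> D i (pick Q0 c')"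
      using I(3)[OF c(1) h(1)] I(3)[OF c(2) h(1)] unfolding In_def by auto
    then show ?thesis
      using QD(3)[of "pick Q0 c" i "pick Q0 c'" "y c" "y c'"] pick_in c pick_less[OF \<open>c < c'\<close> c(2)] TQ[OF iT]
      by simp
  qed
  have "(\<forall>i\<in>I. mono_on (y ` {..<n}) (A i)) \<or> (\<forall>i\<in>I. antimono_on (y ` {..<n}) (A i))"
  proof (cases u0)
    case True
    then have "\<forall>i\<in>I. mono_on (y ` {..<n}) (A i)" using row by (intro ballI mono_onI_less) auto
    then show ?thesis ..
  next
    case False
    then have "\<forall>i\<in>I. antimono_on (y ` {..<n}) (A i)" using row by (intro ballI antimono_onI_less) auto
    then show ?thesis ..
  qed
  moreover have "\<forall>j\<in>y ` {..<n}. mono_on I (\<lambda>i. A i j)"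
    using I(4) by (intro ballI mono_onI_less) (auto intro: less_imp_le)
  ultimately have "mono_block A I (y ` {..<n})" unfolding mono_block_def by blast
  moreover have "I \<subseteq> {..<M}" using I(1) unfolding T_def by auto
  ultimately show False using no_block I(2) cJ JC by blast
qed

section \<open>Estimates of the parameters by powers of n\<close>

lemma gain_le:
  assumes n: "n \<ge> 2"
  shows "gain n \<le> n ^ (6 + 2 * n + 13 * n\<^sup>2 + 7 * n ^ 3)"
proof -
  have a: "2 ^ k \<le> n ^ k" for k using n by (intro power_mono) auto
  have n2: "2 * n \<le> n\<^sup>2" using n by (simp add: power2_eq_square)
  have "(2 * n) ^ n \<le> (n\<^sup>2) ^ n" using n2 by (intro power_mono) auto
  then have q: "(2 * n) ^ n \<le> n ^ (2 * n)" by (simp add: power_mult)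
  have "8 * (2 * n) ^ n * n ^ (5 * n) \<le> n ^ 3 * n ^ (2 * n) * n ^ (5 * n)"
    using a[of 3] q by (intro mult_mono) auto
  also have "\<dots> = n ^ (3 + 7 * n)" by (simp add: power_add[symmetric] add.commute)
  finally have h: "(8 * (2 * n) ^ n * n ^ (5 * n)) ^ (n\<^sup>2) \<le> (n ^ (3 + 7 * n)) ^ (n\<^sup>2)"
    by (intro power_mono) auto
  have "gain n \<le> n ^ 6 * n ^ (2 * n) * (n ^ (5 * n)) ^ (2 * n) * (n ^ (3 + 7 * n)) ^ (n\<^sup>2)"
    unfolding gain_def using a[of 6] q h by (intro mult_mono) auto
  also have "\<dots> = n ^ (6 + 2 * n + 5 * n * (2 * n) + (3 + 7 * n) * n\<^sup>2)"
    by (simp only: power_add power_mult)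
  also have "6 + 2 * n + 5 * n * (2 * n) + (3 + 7 * n) * n\<^sup>2 = 6 + 2 * n + 13 * n\<^sup>2 + 7 * n ^ 3"
    by (simp add: algebra_simps power2_eq_square power3_eq_cube)
  finally show ?thesis .
qed

lemma size_needed_le:
  assumes n: "n \<ge> 2"
  shows "size_needed n \<le> n ^ (32 * n ^ 4)"
proof -
  have "rows_needed n \<le> n * (n\<^sup>2) ^ n * (n\<^sup>2) ^ (n\<^sup>2) * (n ^ (6 + 2 * n + 13 * n\<^sup>2 + 7 * n ^ 3)) ^ n"
    unfolding rows_needed_def using n gain_le[OF n] by (intro mult_mono power_mono) auto
  also have "\<dots> = n ^ (1 + 2 * n + 2 * n\<^sup>2 + (6 + 2 * n + 13 * n\<^sup>2 + 7 * n ^ 3) * n)"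
    by (simp only: power_add power_mult power_one_right)
  finally have r: "rows_needed n \<le> n ^ (1 + 2 * n + 2 * n\<^sup>2 + (6 + 2 * n + 13 * n\<^sup>2 + 7 * n ^ 3) * n)"
    (is "_ \<le> n ^ ?e") .
  have "size_needed n \<le> n\<^sup>2 * (n\<^sup>2 * ((n ^ ?e)\<^sup>2 * n ^ 4))"
    unfolding size_needed_def using r by (intro mult_mono power_mono) auto
  also have "\<dots> = n ^ (2 + (2 + (?e * 2 + 4)))"
    by (simp only: power_add power_mult)
  also have "\<dots> \<le> n ^ (32 * n ^ 4)"
  proof (rule power_increasing)
    \<comment> \<open>The exponent is 14 n^4 + 26 n^3 + 8 n^2 + 16 n + 10. At n = 2 it is 506
      against 512, so 32 is the least integer factor that works; substituting \<open>k + 2\<close>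
      leaves a comparison of coefficients.\<close>
    obtain k where k: "n = k + 2" using n by (metis add.commute le_Suc_ex)
    show "2 + (2 + (?e * 2 + 4)) \<le> 32 * n ^ 4"
      unfolding k by (simp add: algebra_simps power2_eq_square power3_eq_cube power4_eq_xxxx)
  qed (use n in auto)
  finally show ?thesis .
qed

subsection \<open>The bound for matrices\<close>

lemma monotone_mat_submatrix:
  assumes A: "A \<in> carrier_mat N N" and I: "I \<subseteq> {..<N}" and J: "J \<subseteq> {..<N}"
    and m: "mono_block (\<lambda>i j. A $$ (i, j)) I J"
  shows "monotone_mat (submatrix A I J)"
proof -
  have e: "{i. i < dim_row A \<and> i \<in> I} = I" "{j. j < dim_col A \<and> j \<in> J} = J" using A I J by auto
  have dim: "dim_row (submatrix A I J) = card I" "dim_col (submatrix A I J) = card J"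
    unfolding dim_submatrix e by simp_all
  have ix: "submatrix A I J $$ (i, j) = A $$ (pick I i, pick J j)" if "i < card I" "j < card J" for i j
    using that by (intro submatrix_index) (simp_all add: e)
  have pk: "pick S i \<in> S" if "i < card S" for S i using that by (rule pick_in_set_le)
  have le: "pick S i \<le> pick S j" if "i \<le> j" "j < card S" for S i j
    using pick_mono_le[of j S i] that by (cases "i = j") auto
  \<comment> \<open>\<open>r\<close> stands for \<le> or \<ge>, so both directions are treated at
    once; \<open>pick\<close> is increasing.\<close>
  have rows: "(\<forall>i\<in>I. monotone_on J (\<le>) r (\<lambda>j. A $$ (i, j))) \<Longrightarrow>
      \<forall>i<card I. monotone_on {..<card J} (\<le>) r (\<lambda>j. submatrix A I J $$ (i, j))" for r
    by (simp add: monotone_on_def ix pk le)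
  have cols: "(\<forall>j\<in>J. monotone_on I (\<le>) r (\<lambda>i. A $$ (i, j))) \<Longrightarrow>
      \<forall>j<card J. monotone_on {..<card I} (\<le>) r (\<lambda>i. submatrix A I J $$ (i, j))" for r
    by (simp add: monotone_on_def ix pk le)
  show ?thesis
    using m rows cols unfolding mono_block_def monotone_mat_def dim by meson
qed

lemma has_monotone_submatrix_large:
  assumes n: "n \<ge> 1" and N: "n ^ (32 * n ^ 4) \<le> N" and A: "A \<in> carrier_mat N N"
  shows "has_monotone_submatrix n A"
proof -
  have "\<exists>I J. I \<subseteq> {..<N} \<and> card I = n \<and> J \<subseteq> {..<N} \<and> card J = n \<and>
    mono_block (\<lambda>i j. A $$ (i, j)) I J"
  proof (cases "n = 1")
    case True
    then show ?thesis using N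
      by (intro exI[of _ "{0}"]) (auto simp: mono_block_def monotone_on_def)
  next
    case False
    then have n2: "n \<ge> 2" using n by simp
    have s: "size_needed n \<le> N" using size_needed_le[OF n2] N by linarith
    \<comment> \<open>The block lives in a rectangle with no more rows than columns, so a square of
      side \<open>size_needed n\<close> holds it.\<close>
    have "rows_needed n \<le> (rows_needed n)\<^sup>2" by (simp add: power2_eq_square)
    also have "\<dots> \<le> n ^ 8 * (rows_needed n)\<^sup>2" using n by simp
    also have "\<dots> = size_needed n"
      unfolding size_needed_def by (simp add: power_add[symmetric] flip: mult.assoc)
    finally have "rows_needed n \<le> N" using s by linarith
    then have "{..<rows_needed n} \<subseteq> {..<N}" "{..<size_needed n} \<subseteq> {..<N}" using s by auto
    then show ?thesis
      using exists_mono_block[OF n2, of "\<lambda>i j. A $$ (i, j)"]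
      by (elim exE conjE) (intro exI conjI; (assumption | rule subset_trans)?; assumption)
  qed
  then show ?thesis
    unfolding has_monotone_submatrix_def using monotone_mat_submatrix[OF A] A by auto
qed

theorem theorem1:
  shows "\<exists>c::real. c > 0 \<and>
    (\<forall>n::nat. n \<ge> 1 \<longrightarrow>
      (\<forall>N::nat. real N \<ge> 2 powr (c * real n ^ 4 * (ln (real n))\<^sup>2) \<longrightarrow>
         (\<forall>A::real mat. A \<in> carrier_mat N N \<longrightarrow> has_monotone_submatrix n A)) \<and>
      real (M\<^sub>2 n) \<le> 2 powr (c * real n ^ 4 * (ln (real n))\<^sup>2))"
proof (intro exI[of _ "32 / (ln 2)\<^sup>2 :: real"] conjI allI impI)
  fix n :: nat assume n: "n \<ge> 1"
  \<comment> \<open>The bound n^(32 n^4) has one logarithm in its exponent. One \<open>ln 2\<close>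
    of the constant changes the base from 2 to e, the other turns \<open>ln n\<close> into its
    square via \<open>ln 2 \<le> ln n\<close>; for n = 1 both sides are 1.\<close>
  let ?b = "2 powr (32 / (ln 2)\<^sup>2 * real n ^ 4 * (ln (real n))\<^sup>2) :: real"
  have b: "real (n ^ (32 * n ^ 4)) \<le> ?b"
  proof (cases "n = 1")
    case False
    have l2: "ln 2 > (0::real)" by simp
    have le: "ln 2 \<le> ln (real n)" using n False by (intro ln_mono) auto
    have "ln 2 * ln (real n) \<le> (ln (real n))\<^sup>2"
      unfolding power2_eq_square using le l2 by (intro mult_right_mono) linarith+
    then have "ln (real n) \<le> (ln (real n))\<^sup>2 / ln 2" using l2 by (simp add: field_simps)
    then have "32 * real n ^ 4 * ln (real n) \<le> 32 * real n ^ 4 * ((ln (real n))\<^sup>2 / ln 2)"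
      by (intro mult_left_mono) auto
    also have "\<dots> = 32 / (ln 2)\<^sup>2 * real n ^ 4 * (ln (real n))\<^sup>2 * ln 2"
      using l2 by (simp add: field_simps power2_eq_square)
    finally have "exp (32 * real n ^ 4 * ln (real n)) \<le> ?b"
      unfolding powr_def by simp
    moreover have "real (n ^ (32 * n ^ 4)) = exp (32 * real n ^ 4 * ln (real n))"
      using n by (simp add: powr_realpow[symmetric] powr_def)
    ultimately show ?thesis by simp
  qed simp
  {
    fix N :: nat and A :: "real mat" assume "?b \<le> real N" "A \<in> carrier_mat N N"
    moreover from this have "n ^ (32 * n ^ 4) \<le> N" using b by linarith
    ultimately show "has_monotone_submatrix n A" using has_monotone_submatrix_large[OF n] by blast
  }
  \<comment> \<open>n^(32 n^4) is itself a suitable side length, so \<open>LEAST\<close> is a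
    genuine minimum here.\<close>
  have "M\<^sub>2 n \<le> n ^ (32 * n ^ 4)"
    unfolding M\<^sub>2_def using has_monotone_submatrix_large[OF n order_refl] by (intro Least_le) blast
  then show "real (M\<^sub>2 n) \<le> ?b" using b by linarith
qed simp

end
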